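(* Let $(A,[\,])$ and $(A,\langle\,\rangle)$ be a pair of compatible knot-theoretic ternary groups on the same set $A$, and let $D$ be a diagram of a flat virtual link. Then the number of knot-theoretic ternary group colorings of $D$ (using $[\,]$ at flat crossings and $\langle\,\rangle$ at virtual crossings) is not changed by the Reidemeister moves used for flat virtual links (the flat, virtual and mixed Reidemeister moves).
   Context: A ternary group $(A,[\,])$ is a non-empty set $A$ with an associative operation $[\,]\colon A^3\to A$ (that is, $[[abc]de]=[a[bcd]e]=[ab[cde]]$ for all $a,b,c,d,e$) such that for all $a,b,c\in A$ each of the equations $[zab]=c$, $[azb]=c$, $[abz]=c$ has a unique solution $z\in A$. A knot-theoretic ternary group is a ternary group such that, for all $a,b,c,d\in A$, $[[abc]cd]=[[ab[bcd]][bcd]d]$ and $[ab[bcd]]=[a[abc][[abc]cd]]$; such a group satisfies $[abc]=[cba]$ for all $a,b,c$. The knot-theoretic ternary groups $(A,[\,])$ and $(A,\langle\,\rangle)$ are compatible if $[ab\langle bcd\rangle]=\langle a\langle abc\rangle[\langle abc\rangle cd]\rangle$ for all $a,b,c,d\in A$. A flat virtual link diagram is a 4-regular plane graph (closed loops without vertices being allowed, so that it is the image of a generic immersion of circles in the plane) with two types of vertices, called flat crossings and virtual crossings. A flat virtual link is an equivalence class of such diagrams under planar isotopy and the following local moves (performed in a disk, in either direction). Flat Reidemeister moves: (I) adding a kink with one flat crossing to a strand; (II) passing one strand over an adjacent one so that two flat crossings and a bigon between them are created; (III) moving a strand across a crossing in a triangle all of whose three crossings are flat. Virtual Reidemeister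 moves: the same three moves with all crossings virtual. Mixed Reidemeister type three move: a strand having two virtual crossings with two other strands is moved across the flat crossing of those two strands (a triangle with one flat and two virtual crossings). A knot-theoretic ternary group coloring of $D$ is an assignment of elements of $A$ to the regions (connected components of the complement of $D$ in the plane) such that at every crossing, if the four regions around it, taken in cyclic order, have colors $a,b,c,d$, then $a=[bcd]$ if the crossing is flat, and $a=\langle bcd\rangle$ if it is virtual. (This condition does not depend on the choice of the starting region or of the direction of the cyclic order.) *)

theory Defs
  imports "HOL-Analysis.Analysis" "HOL-Library.Equipollence"
begin

section \<open>Ternary groups\<close>

definition ternary_group :: "'a set \<Rightarrow> ('a \<Rightarrow> 'a \<Rightarrow> 'a \<Rightarrow> 'a) \<Rightarrow> bool" where
  "ternary_group A f \<longleftrightarrow>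
     A \<noteq> {} \<and>
     (\<forall>a\<in>A. \<forall>b\<in>A. \<forall>c\<in>A. f a b c \<in> A) \<and>
     (\<forall>a\<in>A. \<forall>b\<in>A. \<forall>c\<in>A. \<forall>d\<in>A. \<forall>e\<in>A.
        f (f a b c) d e = f a (f b c d) e \<and> f a (f b c d) e = f a b (f c d e)) \<and>
     (\<forall>a\<in>A. \<forall>b\<in>A. \<forall>c\<in>A.
        (\<exists>!z. z \<in> A \<and> f z a b = c) \<and>
        (\<exists>!z. z \<in> A \<and> f a z b = c) \<and>
        (\<exists>!z. z \<in> A \<and> f a b z = c))"

definition knot_theoretic_ternary_group :: "'a set \<Rightarrow> ('a \<Rightarrow> 'a \<Rightarrow> 'a \<Rightarrow> 'a) \<Rightarrow> bool" where
  "knot_theoretic_ternary_group A f \<longleftrightarrow>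
     ternary_group A f \<and>
     (\<forall>a\<in>A. \<forall>b\<in>A. \<forall>c\<in>A. \<forall>d\<in>A.
        f (f a b c) c d = f (f a b (f b c d)) (f b c d) d \<and>
        f a b (f b c d) = f a (f a b c) (f (f a b c) c d))"

definition compatible ::
    "'a set \<Rightarrow> ('a \<Rightarrow> 'a \<Rightarrow> 'a \<Rightarrow> 'a) \<Rightarrow> ('a \<Rightarrow> 'a \<Rightarrow> 'a \<Rightarrow> 'a) \<Rightarrow> bool" where
  "compatible A f v \<longleftrightarrow>
     (\<forall>a\<in>A. \<forall>b\<in>A. \<forall>c\<in>A. \<forall>d\<in>A.
        f a b (v b c d) = v a (v a b c) (f (v a b c) c d))"

section \<open>Diagrams\<close>

text \<open>The same record is used for diagrams in the plane and for the local pictures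
  (tangles) inside a disk that occur in the moves.\<close>

record diagram =
  curve :: "complex set"
  flat_crossings :: "complex set"
  virtual_crossings :: "complex set"

definition line_model :: "complex set" where
  "line_model = {z. Im z = 0}"

definition cross_model :: "complex set" where
  "cross_model = {z. Re z = 0 \<or> Im z = 0}"

text \<open>The map \<open>\<phi>\<close>, restricted to the open unit disk, parametrises a neighbourhood
  of \<open>p\<close> in the plane and carries the model to the part of \<open>X\<close> in that neighbourhood.\<close>

definition local_chart ::
    "complex set \<Rightarrow> complex set \<Rightarrow> complex \<Rightarrow> (complex \<Rightarrow> complex) \<Rightarrow> bool" where
  "local_chart M X p \<phi> \<longleftrightarrow>
     \<phi> 0 = p \<and> open (\<phi> ` ball 0 1) \<and>
     (\<exists>\<psi>. homeomorphism (ball 0 1) (\<phi> ` ball 0 1) \<phi> \<psi>) \<and>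
     (\<forall>z\<in>ball 0 1. \<phi> z \<in> X \<longleftrightarrow> z \<in> M)"

text \<open>A 4-regular plane graph, possibly with closed loops without vertices, is a compact subset
  of the plane in which finitely many points (the vertices, i.e. the crossings) look locally like
  the crossing point of two transverse strands, and all other points look locally like
  an interior point of a single strand.  Equivalently, it is the image of a generic
  (topological) immersion of finitely many circles.\<close>

definition flat_virtual_link_diagram :: "diagram \<Rightarrow> bool" where
  "flat_virtual_link_diagram D \<longleftrightarrow>
     compact (curve D) \<and>
     finite (flat_crossings D) \<and> finite (virtual_crossings D) \<and>
     flat_crossings D \<inter> virtual_crossings D = {} \<and>
     flat_crossings D \<union> virtual_crossings D \<subseteq> curve D \<and>
     (\<forall>p \<in> flat_crossings D \<union> virtual_crossings D. \<exists>\<phi>. local_chart cross_model (curve D) p \<phi>) \<and>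
     (\<forall>p \<in> curve D - (flat_crossings D \<union> virtual_crossings D).
        \<exists>\<phi>. local_chart line_model (curve D) p \<phi>)"

section \<open>Colorings\<close>

definition regions :: "diagram \<Rightarrow> complex set set" where
  "regions D = components (- curve D)"

text \<open>In a cross chart at a crossing, the four open quadrants of the unit disk lie in the
  complement of the curve; the points \<open>(1 + \<i>) / 2 * \<i> ^ k\<close> for \<open>k = 0, 1, 2, 3\<close>
  lie in these quadrants, listed in cyclic order.  The four regions need not be distinct.\<close>

definition region_at :: "diagram \<Rightarrow> (complex \<Rightarrow> complex) \<Rightarrow> nat \<Rightarrow> complex set" where
  "region_at D \<phi> k = connected_component_set (- curve D) (\<phi> ((1 + \<i>) / 2 * \<i> ^ k))"

text \<open>All charts at a crossing are considered, so the relation is required for every choice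
  of the starting region and of the direction of the cyclic order.\<close>

definition colored_crossing ::
    "('a \<Rightarrow> 'a \<Rightarrow> 'a \<Rightarrow> 'a) \<Rightarrow> diagram \<Rightarrow> (complex set \<Rightarrow> 'a) \<Rightarrow> complex \<Rightarrow> bool" where
  "colored_crossing f D \<kappa> p \<longleftrightarrow>
     (\<forall>\<phi>. local_chart cross_model (curve D) p \<phi> \<longrightarrow>
        \<kappa> (region_at D \<phi> 0) =
          f (\<kappa> (region_at D \<phi> 1)) (\<kappa> (region_at D \<phi> 2)) (\<kappa> (region_at D \<phi> 3)))"

definition colorings ::
    "'a set \<Rightarrow> ('a \<Rightarrow> 'a \<Rightarrow> 'a \<Rightarrow> 'a) \<Rightarrow> ('a \<Rightarrow> 'a \<Rightarrow> 'a \<Rightarrow> 'a) \<Rightarrow> diagram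
      \<Rightarrow> (complex set \<Rightarrow> 'a) set" where
  "colorings A f v D =
     {\<kappa> \<in> regions D \<rightarrow>\<^sub>E A.
        (\<forall>p\<in>flat_crossings D. colored_crossing f D \<kappa> p) \<and>
        (\<forall>p\<in>virtual_crossings D. colored_crossing v D \<kappa> p)}"

section \<open>Planar isotopy and Reidemeister moves\<close>

definition planar_isotopic :: "diagram \<Rightarrow> diagram \<Rightarrow> bool" where
  "planar_isotopic D D' \<longleftrightarrow>
     (\<exists>H :: real \<Rightarrow> complex \<Rightarrow> complex.
        continuous_on ({0..1} \<times> UNIV) (\<lambda>(t, z). H t z) \<and>
        (\<forall>t\<in>{0..1}. \<exists>g. homeomorphism UNIV UNIV (H t) g) \<and>
        (\<forall>z. H 0 z = z) \<and>
        curve D' = H 1 ` curve D \<and>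
        flat_crossings D' = H 1 ` flat_crossings D \<and>
        virtual_crossings D' = H 1 ` virtual_crossings D)"

text \<open>The disk in which a move takes place is the image of the following square under a
  homeomorphism of the plane.\<close>

definition square :: "complex set" where
  "square = {z. \<bar>Re z\<bar> \<le> 1 \<and> \<bar>Im z\<bar> \<le> 1}"

text \<open>A strand joining the two lower corners of the square, and the same strand with a kink
  (a triangular loop above the origin, where it crosses itself).\<close>

definition strand :: "complex set" where
  "strand = {z \<in> square. Im z = - \<bar>Re z\<bar>}"

definition kink :: "complex set" where
  "kink = {z \<in> square. \<bar>Im z\<bar> = \<bar>Re z\<bar> \<and> Im z \<le> 1/2 \<or> Im z = 1/2 \<and> \<bar>Re z\<bar> \<le> 1/2}"

text \<open>The disjoint strands \<open>y = 1/2\<close> and \<open>y = -1/2\<close>, and the strands \<open>y = \<bar>x\<bar> - 1/2\<close>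
  and \<open>y = 1/2 - \<bar>x\<bar>\<close> with the same end points, which cross twice and bound a bigon.\<close>

definition parallel_strands :: "complex set" where
  "parallel_strands = {z \<in> square. \<bar>Im z\<bar> = 1/2}"

definition bigon :: "complex set" where
  "bigon = {z \<in> square. Im z = \<bar>Re z\<bar> - 1/2 \<or> Im z = 1/2 - \<bar>Re z\<bar>}"

definition bigon_crossings :: "complex set" where
  "bigon_crossings = {Complex (-1/2) 0, Complex (1/2) 0}"

text \<open>The two diagonals of the square and a third strand from \<open>(-1, 0)\<close> to \<open>(1, 0)\<close> which
  passes above (\<open>s = 1\<close>) or below (\<open>s = -1\<close>) the crossing of the diagonals at the origin.\<close>

definition triangle :: "real \<Rightarrow> complex set" where
  "triangle s = {z \<in> square. \<bar>Im z\<bar> = \<bar>Re z\<bar> \<or> Im z = s * (1 - \<bar>Re z\<bar>) / 2}"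

definition third_strand_crossings :: "real \<Rightarrow> complex set" where
  "third_strand_crossings s = {Complex (-1/3) (s/3), Complex (1/3) (s/3)}"

abbreviation tangle :: "complex set \<Rightarrow> complex set \<Rightarrow> complex set \<Rightarrow> diagram" where
  "tangle X F V \<equiv> \<lparr>curve = X, flat_crossings = F, virtual_crossings = V\<rparr>"

text \<open>Each picture is symmetric under reflection in the imaginary axis, so allowing
  orientation-reversing homeomorphisms of the plane below does not create additional moves.\<close>

inductive reidemeister_tangles :: "diagram \<Rightarrow> diagram \<Rightarrow> bool" where
  flat_I: "reidemeister_tangles (tangle strand {} {}) (tangle kink {0} {})"
| flat_II: "reidemeister_tangles (tangle parallel_strands {} {}) (tangle bigon bigon_crossings {})"
| flat_III: "reidemeister_tangles
    (tangle (triangle 1) ({0} \<union> third_strand_crossings 1) {})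
    (tangle (triangle (-1)) ({0} \<union> third_strand_crossings (-1)) {})"
| virtual_I: "reidemeister_tangles (tangle strand {} {}) (tangle kink {} {0})"
| virtual_II: "reidemeister_tangles (tangle parallel_strands {} {}) (tangle bigon {} bigon_crossings)"
| virtual_III: "reidemeister_tangles
    (tangle (triangle 1) {} ({0} \<union> third_strand_crossings 1))
    (tangle (triangle (-1)) {} ({0} \<union> third_strand_crossings (-1)))"
| mixed_III: "reidemeister_tangles
    (tangle (triangle 1) {0} (third_strand_crossings 1))
    (tangle (triangle (-1)) {0} (third_strand_crossings (-1)))"

text \<open>\<open>contains_tangle h T D\<close>: inside the disk \<open>h ` square\<close>, \<open>D\<close> looks like \<open>T\<close>.\<close>

definition contains_tangle :: "(complex \<Rightarrow> complex) \<Rightarrow> diagram \<Rightarrow> diagram \<Rightarrow> bool" where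
  "contains_tangle h T D \<longleftrightarrow>
     curve D \<inter> h ` square = h ` curve T \<and>
     flat_crossings D \<inter> h ` square = h ` flat_crossings T \<and>
     virtual_crossings D \<inter> h ` square = h ` virtual_crossings T"

definition agree_outside :: "complex set \<Rightarrow> diagram \<Rightarrow> diagram \<Rightarrow> bool" where
  "agree_outside B D D' \<longleftrightarrow>
     curve D - B = curve D' - B \<and>
     flat_crossings D - B = flat_crossings D' - B \<and>
     virtual_crossings D - B = virtual_crossings D' - B"

text \<open>The second disjunct expresses that the moves may be performed in either direction.\<close>

definition reidemeister_move :: "diagram \<Rightarrow> diagram \<Rightarrow> bool" where
  "reidemeister_move D D' \<longleftrightarrow>
     (\<exists>T T' h g. (reidemeister_tangles T T' \<or> reidemeister_tangles T' T) \<and>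
        homeomorphism UNIV UNIV h g \<and>
        contains_tangle h T D \<and> contains_tangle h T' D' \<and>
        agree_outside (h ` square) D D')"

end

theory Submission
  imports Defs
begin

text \<open>A coloring is a locally constant function on the complement of the diagram that satisfies
  an equation at each crossing.  The equation is invariant under the dihedral symmetries of the four
  regions, and two charts at a crossing list these regions in orders that differ by such a
  symmetry; hence one chart per crossing suffices, and homeomorphisms of the plane transport
  colorings.  For a move in a disk, moved to the standard square, a coloring is determined inside the
  square by its values at the boundary, since each face either meets the boundary or is
  bounded by a crossing whose other three colors are known.  Conversely, the colors at the boundary
  extend over the other side of the move: for moves I and II because a crossing equation
  determines each of its four colors from the other three, for move III by the compatibility
  axiom.\<close>

section \<open>Knot-theoretic ternary groups\<close>

text \<open>Two features of the notions shape the proof. Regions, on the other hand, are global: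
  distinct faces inside the square may belong to one region of the diagram, and a move can merge or
  split regions. Functions on points can be cut along the sides of the square and glued again
  without tracking regions. As \<open>A\<close> may be infinite, equality of numbers means
  equipollence, obtained from injections in both directions. Each injection needs two facts about
  different sides of the move: colors on the sides of the square extend over the new picture, and
  they determine the coloring of the old one. The pictures are polygonal, so their faces are unions
  of convex polygons, and the geometry becomes linear arithmetic.\<close>

lemma ktg_closed:
  assumes "knot_theoretic_ternary_group A f" "a \<in> A" "b \<in> A" "c \<in> A"
  shows "f a b c \<in> A"
proof -
  have "\<forall>a\<in>A. \<forall>b\<in>A. \<forall>c\<in>A. f a b c \<in> A"
    using assms(1) unfolding knot_theoretic_ternary_group_def ternary_group_def by (elim conjE)
  then show ?thesis using assms by simp
qed

lemma ktg_assoc: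
  assumes "knot_theoretic_ternary_group A f" "a \<in> A" "b \<in> A" "c \<in> A" "d \<in> A" "e \<in> A"
  shows "f (f a b c) d e = f a b (f c d e)" "f a (f b c d) e = f a b (f c d e)"
proof -
  have "\<forall>a\<in>A. \<forall>b\<in>A. \<forall>c\<in>A. \<forall>d\<in>A. \<forall>e\<in>A.
        f (f a b c) d e = f a (f b c d) e \<and> f a (f b c d) e = f a b (f c d e)"
    using assms(1) unfolding knot_theoretic_ternary_group_def ternary_group_def by (elim conjE)
  then show "f (f a b c) d e = f a b (f c d e)" "f a (f b c d) e = f a b (f c d e)"
    using assms by simp_all
qed

lemma ktg_unique_solution:
  assumes "knot_theoretic_ternary_group A f" "a \<in> A" "b \<in> A" "c \<in> A"
  shows "\<exists>!z. z \<in> A \<and> f z a b = c" "\<exists>!z. z \<in> A \<and> f a z b = c" "\<exists>!z. z \<in> A \<and> f a b z = c"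
proof -
  have "\<forall>a\<in>A. \<forall>b\<in>A. \<forall>c\<in>A.
        (\<exists>!z. z \<in> A \<and> f z a b = c) \<and>
        (\<exists>!z. z \<in> A \<and> f a z b = c) \<and>
        (\<exists>!z. z \<in> A \<and> f a b z = c)"
    using assms(1) unfolding knot_theoretic_ternary_group_def ternary_group_def by (elim conjE)
  then show "\<exists>!z. z \<in> A \<and> f z a b = c" "\<exists>!z. z \<in> A \<and> f a z b = c" "\<exists>!z. z \<in> A \<and> f a b z = c"
    using assms(2-4) by simp_all
qed

lemma ktg_cancel_left:
  assumes "knot_theoretic_ternary_group A f" "f a b c = f a b d"
    "a \<in> A" "b \<in> A" "c \<in> A" "d \<in> A"
  shows "c = d"
  using ktg_unique_solution(3)[OF assms(1,3,4) ktg_closed[OF assms(1)]] assms by metis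

lemma ktg_cancel_middle:
  assumes "knot_theoretic_ternary_group A f" "f a c b = f a d b"
    "a \<in> A" "b \<in> A" "c \<in> A" "d \<in> A"
  shows "c = d"
  using ktg_unique_solution(2)[OF assms(1,3,4) ktg_closed[OF assms(1)]] assms by metis

lemma ktg_cancel_right:
  assumes "knot_theoretic_ternary_group A f" "f c a b = f d a b"
    "a \<in> A" "b \<in> A" "c \<in> A" "d \<in> A"
  shows "c = d"
  using ktg_unique_solution(1)[OF assms(1,3,4) ktg_closed[OF assms(1)]] assms by metis

text \<open>In the covering group of the ternary group this says \<open>bcdbcd = cc\<close>.  The two axioms of a
  knot-theoretic ternary group are equivalent to this relation; it makes \<open>aa\<close> a central
  involution that does not depend on \<open>a\<close>.\<close>

lemma ktg_square:
  assumes K: "knot_theoretic_ternary_group A f" and "b \<in> A" "c \<in> A" "d \<in> A"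
  shows "f c c d = f (f b c d) (f b c d) d"
proof -
  have *: "\<forall>a\<in>A. \<forall>b\<in>A. \<forall>c\<in>A. \<forall>d\<in>A.
        f (f a b c) c d = f (f a b (f b c d)) (f b c d) d \<and>
        f a b (f b c d) = f a (f a b c) (f (f a b c) c d)"
    using K unfolding knot_theoretic_ternary_group_def by (elim conjE)
  have "f (f b b c) c d = f (f b b (f b c d)) (f b c d) d"
    using *[rule_format, OF assms(2,2,3,4)] by (rule conjunct1)
  then have "f b b (f c c d) = f b b (f (f b c d) (f b c d) d)"
    using assms by (simp add: ktg_assoc[OF K] ktg_closed[OF K])
  then show ?thesis
    using assms by (meson ktg_cancel_left[OF K] ktg_closed[OF K])
qed

text \<open>The case \<open>d = c\<close> of \<open>ktg_square\<close> reads
  \<open>bccbcc = cc\<close> in the covering group, so \<open>bccb\<close> is trivial. Padding both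
  sides with \<open>a\<close> on the left and with copies of \<open>c\<close> on the right keeps all
  words of odd length until the cancellation.\<close>

lemma ktg_retract:
  assumes K: "knot_theoretic_ternary_group A f" and "a \<in> A" "b \<in> A" "c \<in> A"
  shows "f (f a b c) c b = a"
proof -
  have "f a (f (f b c c) (f b c c) c) c = f a (f c c c) c"
    using ktg_square[OF K assms(3,4,4)] by simp
  then have "f (f (f a b c) c b) c (f c c c) = f a c (f c c c)"
    using assms by (simp add: ktg_assoc[OF K] ktg_closed[OF K])
  then show ?thesis
    by (rule ktg_cancel_right[OF K]) (simp_all add: assms ktg_closed[OF K])
qed

text \<open>All squares \<open>xx\<close> agree in the covering group. Hence
  \<open>(bcd)(dcb)d\<close> collapses to \<open>bbd = ccd\<close>, while \<open>ktg_square\<close>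
  expands \<open>ccd\<close> to \<open>(bcd)(bcd)d\<close>; cancelling the outer factors compares
  \<open>dcb\<close> with \<open>bcd\<close>.\<close>

lemma ktg_commute:
  assumes K: "knot_theoretic_ternary_group A f" and A: "b \<in> A" "c \<in> A" "d \<in> A"
  shows "f b c d = f d c b"
proof -
  have square: "f x x y = f y y y" if "x \<in> A" "y \<in> A" for x y
  proof -
    have "f (f y y x) x y = f (f y y y) y y"
      using ktg_retract[OF K] that by simp
    then have "f y y (f x x y) = f y y (f y y y)"
      using that by (simp add: ktg_assoc[OF K])
    then show ?thesis
      by (rule ktg_cancel_left[OF K]) (simp_all add: that ktg_closed[OF K])
  qed
  have "f (f b c d) (f d c b) d = f (f (f b c d) d c) b d"
    using A by (simp add: ktg_assoc[OF K] ktg_closed[OF K])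
  also have "\<dots> = f b b d"
    using A by (simp add: ktg_retract[OF K])
  also have "\<dots> = f c c d"
    using A by (simp add: square[of b d] square[of c d])
  also have "\<dots> = f (f b c d) (f b c d) d"
    using A by (rule ktg_square[OF K])
  finally have "f d c b = f b c d"
    by (rule ktg_cancel_middle[OF K]) (simp_all add: A ktg_closed[OF K])
  then show ?thesis by simp
qed

lemma ktg_rotate:
  assumes K: "knot_theoretic_ternary_group A f" and "b \<in> A" "c \<in> A" "d \<in> A"
  shows "f c d (f b c d) = b"
  using ktg_retract[OF K] assms(2-4) ktg_commute[OF K] by (metis ktg_closed[OF K])

text \<open>With \<open>a = f b c d\<close> at a crossing, the relation is invariant under the symmetries of the
  cyclic order \<open>a, b, c, d\<close> of its four regions.\<close>

lemma ktg_dihedral: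
  assumes K: "knot_theoretic_ternary_group A f" and A: "a \<in> A" "b \<in> A" "c \<in> A" "d \<in> A"
    and "a = f b c d"
  shows "a = f d c b" "b = f c d a" "b = f a d c" "c = f d a b" "c = f b a d" "d = f a b c" "d = f c b a"
proof -
  show "a = f d c b"
    using ktg_commute[OF K A(2-4)] assms(6) by simp
  show b: "b = f c d a"
    using ktg_rotate[OF K A(2-4)] assms(6) by simp
  show "b = f a d c"
    using ktg_commute[OF K A(3,4,1)] b by simp
  show c: "c = f d a b"
    using ktg_rotate[OF K A(3,4,1)] b by simp
  show "c = f b a d"
    using ktg_commute[OF K A(4,1,2)] c by simp
  show d: "d = f a b c"
    using ktg_rotate[OF K A(4,1,2)] c by simp
  show "d = f c b a"
    using ktg_commute[OF K A(1-3)] d by simp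
qed

text \<open>For \<open>v = f\<close> compatibility is the second of the two axioms. In this way the
  purely flat and the purely virtual move III become cases of the mixed one.\<close>

lemma compatible_self:
  "knot_theoretic_ternary_group A f \<Longrightarrow> compatible A f f"
  unfolding knot_theoretic_ternary_group_def compatible_def by blast

text \<open>The letters are compass directions for the seven faces of \<open>triangle 1\<close> (\<open>wu\<close> and \<open>wd\<close> are the
  upper and lower western faces) and \<open>t\<close> is the central triangle.  Once \<open>s\<close>, \<open>wd\<close> and \<open>eu\<close> are
  expressed through the other colors, the claim is the compatibility axiom.\<close>

lemma compatible_triangle:
  assumes K: "knot_theoretic_ternary_group A f" and L: "knot_theoretic_ternary_group A v"
    and "compatible A f v"
    and A: "t \<in> A" "n \<in> A" "wu \<in> A" "wd \<in> A" "s \<in> A" "ed \<in> A" "eu \<in> A"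
    and t: "t = f wd s ed" "t = v n wu wd" "t = v n eu ed"
  shows "f wu n eu = v s wd wu"
proof -
  have "f wu n (v n t ed) = v wu (v wu n t) (f (v wu n t) t ed)"
    using assms(3)[unfolded compatible_def, rule_format, OF A(3,2,1,6)] .
  moreover have "eu = v n t ed" "wd = v wu n t"
    by (rule ktg_dihedral(5)[OF L A(1,2,7,6) t(3)], rule ktg_dihedral(7)[OF L A(1-4) t(2)])
  moreover have "s = f wd t ed"
    by (rule ktg_dihedral(5)[OF K A(1,4,5,6) t(1)])
  ultimately show ?thesis
    using ktg_commute[OF L A(3,4,5)] by metis
qed

section \<open>Charts at a crossing\<close>

text \<open>Stated for arbitrary connected sets, so that it applies directly to images of quadrants
  under charts and to convex pieces of faces.\<close>

definition constant_off :: "complex set \<Rightarrow> (complex \<Rightarrow> 'a) \<Rightarrow> bool" where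
  "constant_off X c \<longleftrightarrow> (\<forall>C z w. connected C \<and> C \<inter> X = {} \<and> z \<in> C \<and> w \<in> C \<longrightarrow> c z = c w)"

definition crossing_equation ::
    "('a \<Rightarrow> 'a \<Rightarrow> 'a \<Rightarrow> 'a) \<Rightarrow> (complex \<Rightarrow> 'a) \<Rightarrow> (complex \<Rightarrow> complex) \<Rightarrow> bool" where
  "crossing_equation f c \<phi> \<longleftrightarrow>
     c (\<phi> (Complex (1/2) (1/2))) =
       f (c (\<phi> (Complex (-1/2) (1/2)))) (c (\<phi> (Complex (-1/2) (-1/2)))) (c (\<phi> (Complex (1/2) (-1/2))))"

definition crossing_rule ::
    "('a \<Rightarrow> 'a \<Rightarrow> 'a \<Rightarrow> 'a) \<Rightarrow> complex set \<Rightarrow> (complex \<Rightarrow> 'a) \<Rightarrow> complex \<Rightarrow> bool" where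
  "crossing_rule f X c p \<longleftrightarrow> (\<forall>\<phi>. local_chart cross_model X p \<phi> \<longrightarrow> crossing_equation f c \<phi>)"

lemma constant_offD:
  "constant_off X c \<Longrightarrow> connected C \<Longrightarrow> C \<inter> X = {} \<Longrightarrow> z \<in> C \<Longrightarrow> w \<in> C \<Longrightarrow> c z = c w"
  unfolding constant_off_def by blast

text \<open>This identifies the sample points of \<open>region_at\<close> with those of
  \<open>crossing_equation\<close>.\<close>

lemma corner_points:
  "(1 + \<i>) / 2 * \<i> ^ 0 = Complex (1/2) (1/2)" "(1 + \<i>) / 2 * \<i> ^ 1 = Complex (-1/2) (1/2)"
  "(1 + \<i>) / 2 * \<i> ^ 2 = Complex (-1/2) (-1/2)" "(1 + \<i>) / 2 * \<i> ^ 3 = Complex (1/2) (-1/2)"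
  by (simp_all add: complex_eq_iff power3_eq_cube)

lemma homeomorphism_open_image:
  assumes "homeomorphism S T \<phi> \<psi>" "open S" "open T" "U \<subseteq> S" "open U"
  shows "open (\<phi> ` U)"
proof -
  have "openin (top_of_set T) (\<phi> ` U)"
    using assms by (intro homeomorphism_imp_open_map[OF assms(1)]) (auto simp: openin_open_eq)
  then show ?thesis using assms(3) openin_open_trans by blast
qed

section \<open>Half-planes and the quadrants of the cross\<close>

definition halfplane :: "real \<Rightarrow> real \<Rightarrow> real \<Rightarrow> complex set" where
  "halfplane a b d = {z. a * Re z + b * Im z < d}"

lemma halfplane_eq: "halfplane a b d = {z. inner (Complex a b) z < d}"
  by (simp add: halfplane_def inner_complex_def)

lemma convex_halfplane: "convex (halfplane a b d)"
  unfolding halfplane_eq by (rule convex_halfspace_lt)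

lemma open_halfplane: "open (halfplane a b d)"
  unfolding halfplane_eq by (rule open_halfspace_lt)

definition sgnb :: "bool \<Rightarrow> real" where "sgnb b = (if b then 1 else -1)"

text \<open>The radius varies because a change of charts is defined only on a small disk, while the
  sample points lie in the unit disk. The Booleans are the signs of the coordinates; distinct
  quadrants are adjacent exactly when one component agrees.\<close>

definition quadrant :: "real \<Rightarrow> bool \<times> bool \<Rightarrow> complex set" where
  "quadrant r q = {z \<in> ball 0 r. 0 < sgnb (fst q) * Re z \<and> 0 < sgnb (snd q) * Im z}"

lemma connected_quadrant: "connected (quadrant r q)"
proof -
  have "quadrant r q = ball 0 r \<inter> halfplane (- sgnb (fst q)) 0 0 \<inter> halfplane 0 (- sgnb (snd q)) 0"
    by (auto simp: quadrant_def halfplane_def)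
  then show ?thesis
    by (simp add: convex_Int convex_halfplane convex_connected)
qed

lemma quadrant_unique: "z \<in> quadrant r q \<Longrightarrow> z \<in> quadrant r' q' \<Longrightarrow> q = q'"
  by (cases q; cases q') (auto simp: quadrant_def sgnb_def split: if_splits)

lemma quadrant_exists:
  "z \<in> ball 0 r \<Longrightarrow> z \<notin> cross_model \<Longrightarrow> z \<in> quadrant r (0 < Re z, 0 < Im z)"
  by (auto simp: quadrant_def sgnb_def cross_model_def)

lemma quadrant_point:
  assumes "0 < r"
  shows "Complex (r / 2 * sgnb (fst q)) (r / 2 * sgnb (snd q)) \<in> quadrant r q"
proof -
  have "(cmod (Complex (r / 2 * sgnb (fst q)) (r / 2 * sgnb (snd q))))\<^sup>2 < r\<^sup>2"
    unfolding cmod_power2 using assms by (simp add: sgnb_def power2_eq_square)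
  then have "cmod (Complex (r / 2 * sgnb (fst q)) (r / 2 * sgnb (snd q))) < r"
    using assms by (auto intro: power2_less_imp_less)
  then show ?thesis
    using assms by (auto simp: quadrant_def sgnb_def)
qed

lemma corner_quadrant:
  "Complex (1/2) (1/2) \<in> quadrant 1 (True, True)" "Complex (-1/2) (1/2) \<in> quadrant 1 (False, True)"
  "Complex (-1/2) (-1/2) \<in> quadrant 1 (False, False)" "Complex (1/2) (-1/2) \<in> quadrant 1 (True, False)"
  using quadrant_point[of 1 "(True, True)"] quadrant_point[of 1 "(False, True)"]
    quadrant_point[of 1 "(False, False)"] quadrant_point[of 1 "(True, False)"]
  by (simp_all add: sgnb_def)

text \<open>The midpoint of an arm is a limit of both quadrants bordering it. This topological form
  of adjacency can be carried through a map that is merely continuous.\<close>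

lemma arm_closure_quadrant:
  assumes "0 < r"
  shows "Complex (r / 2 * sgnb s) 0 \<in> closure (quadrant r (s, t))"
    and "Complex 0 (r / 2 * sgnb t) \<in> closure (quadrant r (s, t))"
proof -
  have bound: "Complex x y \<in> ball 0 r" if "\<bar>x\<bar> + \<bar>y\<bar> < r" for x y
    using cmod_le[of "Complex x y"] that by simp
  \<comment> \<open>The offset \<open>min (e / 2) (r / 4)\<close> from the arm is below
    \<open>e\<close>, and together with \<open>r / 2\<close> it stays below \<open>r\<close>, so the
    shifted point is still in the disk.\<close>
  have d: "0 < min (e / 2) (r / 4)" "min (e / 2) (r / 4) < e" "r / 2 + min (e / 2) (r / 4) < r" if "0 < e" for e
    using assms that by auto
  show "Complex (r / 2 * sgnb s) 0 \<in> closure (quadrant r (s, t))"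
    unfolding closure_approachable
  proof (intro allI impI)
    fix e :: real assume "0 < e"
    let ?m = "min (e / 2) (r / 4)"
    have "Complex (r / 2 * sgnb s) (?m * sgnb t) \<in> quadrant r (s, t)"
      using bound[of "r / 2 * sgnb s" "?m * sgnb t"] d[OF \<open>0 < e\<close>] assms
      by (auto simp: quadrant_def sgnb_def abs_mult simp del: mem_ball)
    moreover have "dist (Complex (r / 2 * sgnb s) (?m * sgnb t)) (Complex (r / 2 * sgnb s) 0) < e"
      using d[OF \<open>0 < e\<close>] by (simp add: dist_complex_def cmod_def complex_diff sgnb_def)
    ultimately show "\<exists>y\<in>quadrant r (s, t). dist y (Complex (r / 2 * sgnb s) 0) < e" by blast
  qed
  show "Complex 0 (r / 2 * sgnb t) \<in> closure (quadrant r (s, t))"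
    unfolding closure_approachable
  proof (intro allI impI)
    fix e :: real assume "0 < e"
    let ?m = "min (e / 2) (r / 4)"
    have "Complex (?m * sgnb s) (r / 2 * sgnb t) \<in> quadrant r (s, t)"
      using bound[of "?m * sgnb s" "r / 2 * sgnb t"] d[OF \<open>0 < e\<close>] assms
      by (auto simp: quadrant_def sgnb_def abs_mult simp del: mem_ball)
    moreover have "dist (Complex (?m * sgnb s) (r / 2 * sgnb t)) (Complex 0 (r / 2 * sgnb t)) < e"
      using d[OF \<open>0 < e\<close>] by (simp add: dist_complex_def cmod_def complex_diff sgnb_def)
    ultimately show "\<exists>y\<in>quadrant r (s, t). dist y (Complex 0 (r / 2 * sgnb t)) < e" by blast
  qed
qed

lemma connected_sign:
  fixes g :: "complex \<Rightarrow> real"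
  assumes "connected S" "continuous_on S g" "\<And>z. z \<in> S \<Longrightarrow> g z \<noteq> 0" "z \<in> S" "w \<in> S" "0 < g z"
  shows "0 < g w"
proof (rule ccontr)
  assume "\<not> 0 < g w"
  then have "0 \<in> {g w..g z}" using assms(6) by simp
  also have "\<dots> \<subseteq> g ` S"
    using assms by (intro connected_contains_Icc connected_continuous_image) auto
  finally show False using assms(3) by auto
qed

lemma positive_near_closure:
  fixes g :: "complex \<Rightarrow> real"
  assumes "open U" "continuous_on U g" "a \<in> U" "a \<in> closure S" "0 < g a"
  shows "\<exists>z\<in>S \<inter> U. 0 < g z"
proof -
  have "open (g -` {0<..} \<inter> U)"
    using assms continuous_on_open_vimage open_greaterThan by blast
  then have "(g -` {0<..} \<inter> U) \<inter> S \<noteq> {}"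
    using assms open_Int_closure_eq_empty[of "g -` {0<..} \<inter> U" S] by auto
  then show ?thesis by auto
qed

text \<open>Read the pairs as vertices of a square. A closed walk of four steps that visits all four
  vertices and moves along edges is an automorphism of the 4-cycle, and there are eight of
  these.\<close>

lemma quadrant_permutation_dihedral:
  fixes p1 p2 p3 p4 :: "bool \<times> bool"
  assumes "\<And>q. q \<in> {p1, p2, p3, p4}"
    and "fst p1 = fst p2 \<or> snd p1 = snd p2" "fst p2 = fst p3 \<or> snd p2 = snd p3"
    and "fst p3 = fst p4 \<or> snd p3 = snd p4" "fst p4 = fst p1 \<or> snd p4 = snd p1"
  shows "(p1, p2, p3, p4) \<in>
    {((True, True), (False, True), (False, False), (True, False)),
     ((False, True), (False, False), (True, False), (True, True)),
     ((False, False), (True, False), (True, True), (False, True)),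
     ((True, False), (True, True), (False, True), (False, False)),
     ((True, True), (True, False), (False, False), (False, True)),
     ((False, True), (True, True), (True, False), (False, False)),
     ((False, False), (False, True), (True, True), (True, False)),
     ((True, False), (False, False), (False, True), (True, True))}"
proof -
  have "(True, True) \<in> {p1, p2, p3, p4}" "(True, False) \<in> {p1, p2, p3, p4}"
     "(False, True) \<in> {p1, p2, p3, p4}" "(False, False) \<in> {p1, p2, p3, p4}"
    using assms(1) by blast+
  with assms(2-) show ?thesis
    by (cases p1; cases p2; cases p3; cases p4) (simp; argo)
qed

text \<open>Near the crossing, the transition map between two charts permutes the quadrants.  It maps
  the arms of the cross to the arms, so adjacent quadrants go to adjacent quadrants, and the
  permutation is one of the eight symmetries in \<open>ktg_dihedral\<close>.\<close>

lemma crossing_equation_chart_change: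
  assumes K: "knot_theoretic_ternary_group A f"
    and c: "constant_off X c" "\<And>z. z \<notin> X \<Longrightarrow> c z \<in> A"
    and \<phi>: "local_chart cross_model X p \<phi>" and \<phi>': "local_chart cross_model X p \<phi>'"
    and eq: "crossing_equation f c \<phi>'"
  shows "crossing_equation f c \<phi>"
proof -
  let ?B = "ball (0::complex) 1"
  obtain \<psi> where \<psi>: "homeomorphism ?B (\<phi> ` ?B) \<phi> \<psi>" using \<phi> by (auto simp: local_chart_def)
  obtain \<psi>' where \<psi>': "homeomorphism ?B (\<phi>' ` ?B) \<phi>' \<psi>'" using \<phi>' by (auto simp: local_chart_def)
  have o: "open (\<phi> ` ?B)" "open (\<phi>' ` ?B)" and p: "\<phi> 0 = p" "\<phi>' 0 = p"
    and X: "\<And>z. z \<in> ?B \<Longrightarrow> \<phi> z \<in> X \<longleftrightarrow> z \<in> cross_model" "\<And>z. z \<in> ?B \<Longrightarrow> \<phi>' z \<in> X \<longleftrightarrow> z \<in> cross_model"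
    using \<phi> \<phi>' by (auto simp: local_chart_def)
  have cont: "continuous_on ?B \<phi>" "continuous_on ?B \<phi>'" "continuous_on (\<phi>' ` ?B) \<psi>'"
    using \<psi> \<psi>' by (auto simp: homeomorphism_def)
  \<comment> \<open>The images of the two charts need not be nested. On a small disk of radius
    \<open>r\<close> the image of \<phi> lies in that of \<phi>', so there the transition map \<tau>
    makes sense.\<close>
  have "open (\<phi> -` (\<phi>' ` ?B) \<inter> ?B)"
    using continuous_on_open_vimage[of ?B \<phi>] cont(1) o(2) by blast
  moreover have "0 \<in> \<phi> -` (\<phi>' ` ?B) \<inter> ?B"
    using p by (auto simp: image_iff intro!: bexI[of _ 0])
  ultimately obtain r where r: "0 < r" "ball 0 r \<subseteq> \<phi> -` (\<phi>' ` ?B) \<inter> ?B"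
    by (meson openE)
  define \<tau> where "\<tau> = \<psi>' \<circ> \<phi>"
  have \<tau>: "\<tau> z \<in> ?B" "\<phi>' (\<tau> z) = \<phi> z" "\<tau> z \<in> cross_model \<longleftrightarrow> z \<in> cross_model" "z \<in> ?B"
    if "z \<in> ball 0 r" for z
  proof -
    show zB: "z \<in> ?B" using r that by blast
    have z: "\<phi> z \<in> \<phi>' ` ?B" using r that by blast
    have "\<psi>' ` (\<phi>' ` ?B) = ?B" using \<psi>' unfolding homeomorphism_def by blast
    then show t: "\<tau> z \<in> ?B"
      using z by (auto simp: \<tau>_def)
    show e: "\<phi>' (\<tau> z) = \<phi> z"
      using homeomorphism_apply2[OF \<psi>' z] by (simp add: \<tau>_def)
    show "\<tau> z \<in> cross_model \<longleftrightarrow> z \<in> cross_model"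
      using X(1)[OF zB] X(2)[OF t] e by simp
  qed
  have \<tau>cont: "continuous_on (ball 0 r) \<tau>"
    unfolding \<tau>_def using r(2)
    by (intro continuous_on_compose continuous_on_subset[OF cont(1)] continuous_on_subset[OF cont(3)]) blast+
  have \<tau>0: "\<tau> 0 = 0"
    using homeomorphism_apply1[OF \<psi>', of 0] p by (simp add: \<tau>_def)
  have \<tau>nz: "\<tau> z \<noteq> 0" if "z \<in> ball 0 r" "z \<noteq> 0" for z
  proof
    assume "\<tau> z = 0"
    then have "\<phi> z = \<phi> 0" using \<tau>(2)[OF that(1)] p by simp
    moreover have "inj_on \<phi> ?B" using \<psi> by (metis homeomorphism_def inj_on_inverseI)
    ultimately show False using \<tau>(4)[OF that(1)] that(2) by (auto simp: inj_on_def)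
  qed
  \<comment> \<open>The image of \<tau> contains a disk around 0. Every quadrant reaches into that
    disk, which makes the induced map \<pi> of quadrants surjective.\<close>
  obtain e where e: "0 < e" "ball 0 e \<subseteq> \<tau> ` ball 0 r"
  proof -
    have "open (\<phi> ` ball 0 r)"
      using homeomorphism_open_image[OF \<psi> _ o(1)] r(2) by auto
    then have "open (\<phi>' -` (\<phi> ` ball 0 r) \<inter> ?B)"
      using continuous_on_open_vimage[of ?B \<phi>'] cont(2) by blast
    moreover have "0 \<in> \<phi>' -` (\<phi> ` ball 0 r) \<inter> ?B"
      using p r(1) by (auto simp: image_iff intro!: bexI[of _ 0])
    ultimately obtain e where e: "0 < e" "ball 0 e \<subseteq> \<phi>' -` (\<phi> ` ball 0 r) \<inter> ?B"
      by (meson openE)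
    have "w \<in> \<tau> ` ball 0 r" if "w \<in> ball 0 e" for w
    proof -
      obtain z where z: "z \<in> ball 0 r" "\<phi>' w = \<phi> z" and w: "w \<in> ?B" using e(2) \<open>w \<in> ball 0 e\<close> by blast
      have "\<tau> z = w"
        using homeomorphism_apply1[OF \<psi>' w] z(2) by (simp add: \<tau>_def)
      then show ?thesis using z by blast
    qed
    then show ?thesis using that e(1) by blast
  qed
  \<comment> \<open>A quadrant avoids the cross, and hence so does its image. The coordinates of
    \<tau> therefore have no zero on this connected set and keep their signs.\<close>
  have "\<exists>q'. \<forall>z\<in>quadrant r q. \<tau> z \<in> quadrant 1 q'" for q
  proof -
    obtain z0 where z0: "z0 \<in> quadrant r q" using quadrant_point[OF r(1)] by blast
    have sub: "quadrant r q \<subseteq> ball 0 r" by (auto simp: quadrant_def)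
    have nc: "Re (\<tau> z) \<noteq> 0" "Im (\<tau> z) \<noteq> 0" if "z \<in> quadrant r q" for z
      using \<tau>(3)[of z] that sub by (auto simp: quadrant_def cross_model_def)
    define q' where "q' = (0 < Re (\<tau> z0), 0 < Im (\<tau> z0))"
    have "\<tau> z \<in> quadrant 1 q'" if z: "z \<in> quadrant r q" for z
    proof -
      have "0 < sgnb (fst q') * Re (\<tau> z)"
      proof (rule connected_sign[OF connected_quadrant _ _ z0 z])
        show "continuous_on (quadrant r q) (\<lambda>z. sgnb (fst q') * Re (\<tau> z))"
          by (intro continuous_intros continuous_on_subset[OF \<tau>cont] sub)
      qed (use nc z0 in \<open>auto simp: q'_def sgnb_def not_less less_le\<close>)
      moreover have "0 < sgnb (snd q') * Im (\<tau> z)"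
      proof (rule connected_sign[OF connected_quadrant _ _ z0 z])
        show "continuous_on (quadrant r q) (\<lambda>z. sgnb (snd q') * Im (\<tau> z))"
          by (intro continuous_intros continuous_on_subset[OF \<tau>cont] sub)
      qed (use nc z0 in \<open>auto simp: q'_def sgnb_def not_less less_le\<close>)
      ultimately show ?thesis
        using \<tau>(1) sub z by (auto simp: quadrant_def)
    qed
    then show ?thesis by blast
  qed
  then obtain \<pi> where \<pi>: "\<And>q z. z \<in> quadrant r q \<Longrightarrow> \<tau> z \<in> quadrant 1 (\<pi> q)"
    by metis
  have surj: "\<exists>q. \<pi> q = q'" for q'
  proof -
    obtain w where w: "w \<in> quadrant e q'" using quadrant_point[OF e(1)] by blast
    then obtain z where z: "z \<in> ball 0 r" "w = \<tau> z" using e(2) by (auto simp: quadrant_def)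
    have "w \<notin> cross_model" using w by (auto simp: quadrant_def cross_model_def)
    then have "z \<notin> cross_model" using \<tau>(3) z by blast
    then have "\<tau> z \<in> quadrant 1 (\<pi> (0 < Re z, 0 < Im z))" using \<pi> quadrant_exists z(1) by blast
    then show ?thesis using quadrant_unique w z(2) by blast
  qed
  \<comment> \<open>The common limit point \<open>a\<close> is not sent to 0, so some coordinate of
    \<open>\<tau> a\<close> is nonzero; by continuity both image quadrants inherit its sign.\<close>
  have adj: "fst (\<pi> q1) = fst (\<pi> q2) \<or> snd (\<pi> q1) = snd (\<pi> q2)"
    if a: "a \<in> ball 0 r" "a \<noteq> 0" "a \<in> closure (quadrant r q1)" "a \<in> closure (quadrant r q2)" for a q1 q2
  proof -
    have side: "0 < sgnb (fst (\<pi> q)) * Re (\<tau> a)"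
      if h: "Re (\<tau> a) \<noteq> 0" "a \<in> closure (quadrant r q)" for q
    proof (rule ccontr)
      assume "\<not> ?thesis"
      then have pos: "0 < - (sgnb (fst (\<pi> q)) * Re (\<tau> a))"
        using h(1) by (auto simp: sgnb_def split: if_splits)
      have "continuous_on (ball 0 r) (\<lambda>z. - (sgnb (fst (\<pi> q)) * Re (\<tau> z)))"
        by (intro continuous_intros \<tau>cont)
      from positive_near_closure[OF open_ball this a(1) h(2) pos]
      obtain z where "z \<in> quadrant r q" "0 < - (sgnb (fst (\<pi> q)) * Re (\<tau> z))"
        by blast
      then show False using \<pi>[of z q] by (auto simp: quadrant_def)
    qed
    have side': "0 < sgnb (snd (\<pi> q)) * Im (\<tau> a)"
      if h: "Im (\<tau> a) \<noteq> 0" "a \<in> closure (quadrant r q)" for q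
    proof (rule ccontr)
      assume "\<not> ?thesis"
      then have pos: "0 < - (sgnb (snd (\<pi> q)) * Im (\<tau> a))"
        using h(1) by (auto simp: sgnb_def split: if_splits)
      have "continuous_on (ball 0 r) (\<lambda>z. - (sgnb (snd (\<pi> q)) * Im (\<tau> z)))"
        by (intro continuous_intros \<tau>cont)
      from positive_near_closure[OF open_ball this a(1) h(2) pos]
      obtain z where "z \<in> quadrant r q" "0 < - (sgnb (snd (\<pi> q)) * Im (\<tau> z))"
        by blast
      then show False using \<pi>[of z q] by (auto simp: quadrant_def)
    qed
    have "Re (\<tau> a) \<noteq> 0 \<or> Im (\<tau> a) \<noteq> 0"
      using \<tau>nz[OF a(1,2)] by (auto simp: complex_eq_iff)
    then show ?thesis
      using side[OF _ a(3)] side[OF _ a(4)] side'[OF _ a(3)] side'[OF _ a(4)]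
      by (auto simp: sgnb_def split: if_splits)
  qed
  \<comment> \<open>The map \<pi> was read off from small quadrants, but the equation samples points
    at the scale of the unit disk. A point \<open>z0\<close> of the small quadrant is joined to the
    sample points inside the large quadrants of the two charts.\<close>
  have color: "c (\<phi> z) = c (\<phi>' w)" if "z \<in> quadrant 1 q" "w \<in> quadrant 1 (\<pi> q)" for z w q
  proof -
    obtain z0 where z0: "z0 \<in> quadrant r q" using quadrant_point[OF r(1)] by blast
    have sub: "quadrant 1 q \<subseteq> ?B - cross_model" for q by (auto simp: quadrant_def cross_model_def)
    have z0': "z0 \<in> quadrant 1 q" using z0 r(2) by (auto simp: quadrant_def)
    have "c (\<phi> z) = c (\<phi> z0)"
    proof (rule constant_offD[OF c(1)])
      show "connected (\<phi> ` quadrant 1 q)"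
        using sub by (intro connected_continuous_image connected_quadrant continuous_on_subset[OF cont(1)]) blast
      show "\<phi> ` quadrant 1 q \<inter> X = {}" using X(1) sub by blast
    qed (use that z0' in auto)
    also have "\<phi> z0 = \<phi>' (\<tau> z0)"
      using \<tau>(2) z0 by (auto simp: quadrant_def)
    also have "c (\<phi>' (\<tau> z0)) = c (\<phi>' w)"
    proof (rule constant_offD[OF c(1)])
      show "connected (\<phi>' ` quadrant 1 (\<pi> q))"
        using sub by (intro connected_continuous_image connected_quadrant continuous_on_subset[OF cont(2)]) blast
      show "\<phi>' ` quadrant 1 (\<pi> q) \<inter> X = {}" using X(2) sub by blast
    qed (use that \<pi>[OF z0] in auto)
    finally show ?thesis .
  qed
  let ?p1 = "\<pi> (True, True)" and ?p2 = "\<pi> (False, True)" and ?p3 = "\<pi> (False, False)" and ?p4 = "\<pi> (True, False)"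
  note arm = arm_closure_quadrant[OF r(1)]
  have nz: "Complex (r / 2 * sgnb s) 0 \<in> ball 0 r" "Complex (r / 2 * sgnb s) 0 \<noteq> 0"
    "Complex 0 (r / 2 * sgnb s) \<in> ball 0 r" "Complex 0 (r / 2 * sgnb s) \<noteq> 0" for s
    using r(1) by (simp_all add: sgnb_def complex_eq_iff cmod_def)
  have all: "q' \<in> {?p1, ?p2, ?p3, ?p4}" for q'
  proof -
    obtain s t where "\<pi> (s, t) = q'" using surj[of q'] by auto
    then show ?thesis by (cases s; cases t) auto
  qed
  define y where "y q = c (\<phi>' (Complex (1 / 2 * sgnb (fst q)) (1 / 2 * sgnb (snd q))))" for q
  have y: "y q = c (\<phi>' w)" if "w \<in> quadrant 1 q" for w q
  proof -
    obtain q0 where q0: "\<pi> q0 = q" using surj by blast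
    obtain z where z: "z \<in> quadrant 1 q0" using quadrant_point[OF zero_less_one] by blast
    show ?thesis
      using color[OF z] that quadrant_point[OF zero_less_one, of q] q0 unfolding y_def by metis
  qed
  have colors: "c (\<phi> (Complex (1/2) (1/2))) = y ?p1" "c (\<phi> (Complex (-1/2) (1/2))) = y ?p2"
     "c (\<phi> (Complex (-1/2) (-1/2))) = y ?p3" "c (\<phi> (Complex (1/2) (-1/2))) = y ?p4"
    unfolding y_def by (rule color; rule corner_quadrant quadrant_point[OF zero_less_one])+
  have yA: "y q \<in> A" for q
    unfolding y_def using quadrant_point[OF zero_less_one, of q] X(2)
    by (intro c(2)) (auto simp: quadrant_def cross_model_def)
  have Y: "y (True, True) = f (y (False, True)) (y (False, False)) (y (True, False))"
    using eq by (simp add: crossing_equation_def y[OF corner_quadrant(1)] y[OF corner_quadrant(2)]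
        y[OF corner_quadrant(3)] y[OF corner_quadrant(4)])
  note dihedral = ktg_dihedral[OF K yA yA yA yA Y]
  have "(?p1, ?p2, ?p3, ?p4) \<in>
    {((True, True), (False, True), (False, False), (True, False)),
     ((False, True), (False, False), (True, False), (True, True)),
     ((False, False), (True, False), (True, True), (False, True)),
     ((True, False), (True, True), (False, True), (False, False)),
     ((True, True), (True, False), (False, False), (False, True)),
     ((False, True), (True, True), (True, False), (False, False)),
     ((False, False), (False, True), (True, True), (True, False)),
     ((True, False), (False, False), (False, True), (True, True))}"
  proof (rule quadrant_permutation_dihedral[OF all])
    show "fst ?p1 = fst ?p2 \<or> snd ?p1 = snd ?p2"
      by (rule adj[OF nz(3,4) arm(2) arm(2)])
    show "fst ?p2 = fst ?p3 \<or> snd ?p2 = snd ?p3"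
      by (rule adj[OF nz(1,2) arm(1) arm(1)])
    show "fst ?p3 = fst ?p4 \<or> snd ?p3 = snd ?p4"
      by (rule adj[OF nz(3,4) arm(2) arm(2)])
    show "fst ?p4 = fst ?p1 \<or> snd ?p4 = snd ?p1"
      by (rule adj[OF nz(1,2) arm(1) arm(1)])
  qed
  \<comment> \<open>Each of the eight permutations yields \<open>Y\<close> itself or one of the
    seven equations in \<open>dihedral\<close>.\<close>
  then have "y ?p1 = f (y ?p2) (y ?p3) (y ?p4)"
    unfolding insert_iff empty_iff prod.inject
    apply (elim disjE conjE)
    using Y dihedral apply metis+
    done
  then show ?thesis
    unfolding crossing_equation_def colors .
qed

lemma crossing_ruleI:
  assumes "knot_theoretic_ternary_group A f"
    and "constant_off X c" "\<And>z. z \<notin> X \<Longrightarrow> c z \<in> A"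
    and "local_chart cross_model X p \<phi>" "crossing_equation f c \<phi>"
  shows "crossing_rule f X c p"
  unfolding crossing_rule_def using crossing_equation_chart_change[OF assms(1-3) _ assms(4,5)] by blast

section \<open>Colorings as functions on points\<close>

text \<open>A coloring is handled as a function on points of the plane; its values on the curve
  are irrelevant.\<close>

definition point_coloring ::
    "'a set \<Rightarrow> ('a \<Rightarrow> 'a \<Rightarrow> 'a \<Rightarrow> 'a) \<Rightarrow> ('a \<Rightarrow> 'a \<Rightarrow> 'a \<Rightarrow> 'a) \<Rightarrow> diagram \<Rightarrow> (complex \<Rightarrow> 'a) \<Rightarrow> bool" where
  "point_coloring A f v D c \<longleftrightarrow>
     (\<forall>z. z \<notin> curve D \<longrightarrow> c z \<in> A) \<and> constant_off (curve D) c \<and>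
     (\<forall>p\<in>flat_crossings D. crossing_rule f (curve D) c p) \<and>
     (\<forall>p\<in>virtual_crossings D. crossing_rule v (curve D) c p)"

definition pointwise :: "diagram \<Rightarrow> (complex set \<Rightarrow> 'a) \<Rightarrow> complex \<Rightarrow> 'a" where
  "pointwise D \<kappa> z = \<kappa> (connected_component_set (- curve D) z)"

lemma colored_crossing_iff:
  "colored_crossing f D \<kappa> p \<longleftrightarrow> crossing_rule f (curve D) (pointwise D \<kappa>) p"
  unfolding colored_crossing_def crossing_rule_def crossing_equation_def region_at_def
    pointwise_def corner_points by (rule refl)

lemma region_of_point:
  "z \<notin> curve D \<Longrightarrow> connected_component_set (- curve D) z \<in> regions D"
  by (auto simp: regions_def components_def)

text \<open>The sample points of a chart lie in open quadrants and hence off the curve, so values on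
  the curve never enter the rule.\<close>

lemma crossing_rule_cong:
  assumes "\<And>z. z \<notin> X \<Longrightarrow> c z = c' z"
  shows "crossing_rule f X c p \<longleftrightarrow> crossing_rule f X c' p"
proof -
  have "crossing_equation f c \<phi> \<longleftrightarrow> crossing_equation f c' \<phi>" if "local_chart cross_model X p \<phi>" for \<phi>
  proof -
    have "\<phi> z \<notin> X" if "z \<in> quadrant 1 q" for z q
      using that \<open>local_chart cross_model X p \<phi>\<close> by (auto simp: local_chart_def quadrant_def cross_model_def)
    then have "c (\<phi> z) = c' (\<phi> z)" if "z \<in> quadrant 1 q" for z q
      using that assms by blast
    then show ?thesis
      unfolding crossing_equation_def using corner_quadrant by metis
  qed
  then show ?thesis unfolding crossing_rule_def by blast
qed

lemma point_coloring_pointwise: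
  assumes "\<kappa> \<in> colorings A f v D"
  shows "point_coloring A f v D (pointwise D \<kappa>)"
proof -
  have "constant_off (curve D) (pointwise D \<kappa>)"
    unfolding constant_off_def pointwise_def
  proof (intro allI impI, elim conjE)
    fix C z w assume "connected C" "C \<inter> curve D = {}" "z \<in> C" "w \<in> C"
    then have "w \<in> connected_component_set (- curve D) z"
      using connected_component_maximal[of z C "- curve D"] by blast
    then show "\<kappa> (connected_component_set (- curve D) z) = \<kappa> (connected_component_set (- curve D) w)"
      by (metis connected_component_eq)
  qed
  moreover have "pointwise D \<kappa> z \<in> A" if "z \<notin> curve D" for z
    using assms region_of_point[OF that] by (auto simp: colorings_def pointwise_def)
  ultimately show ?thesis
    using assms by (auto simp: point_coloring_def colorings_def colored_crossing_iff)
qed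

lemma coloring_of_point_coloring:
  assumes "point_coloring A f v D c"
  obtains \<kappa> where "\<kappa> \<in> colorings A f v D" "\<And>z. z \<notin> curve D \<Longrightarrow> pointwise D \<kappa> z = c z"
proof
  \<comment> \<open>A region gets the color of an arbitrarily chosen point in it;
    \<open>restrict\<close> makes the function extensional, as membership in
    \<open>colorings\<close> demands.\<close>
  define \<kappa> where "\<kappa> = restrict (\<lambda>R. c (SOME z. z \<in> R)) (regions D)"
  have some: "(SOME z. z \<in> R) \<in> R" if "R \<in> regions D" for R
    using that in_components_nonempty[of R] by (auto simp: regions_def some_in_eq)
  show p: "pointwise D \<kappa> z = c z" if "z \<notin> curve D" for z
  proof -
    let ?R = "connected_component_set (- curve D) z"
    have "c (SOME z. z \<in> ?R) = c z"
    proof (rule constant_offD[of "curve D" c ?R])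
      show "constant_off (curve D) c" using assms by (simp add: point_coloring_def)
      show "?R \<inter> curve D = {}" using connected_component_subset by fastforce
    qed (use that some[OF region_of_point[OF that]] in auto)
    then show ?thesis
      using region_of_point[OF that] by (simp add: pointwise_def \<kappa>_def)
  qed
  have "\<kappa> \<in> regions D \<rightarrow>\<^sub>E A"
  proof -
    have "c (SOME z. z \<in> R) \<in> A" if "R \<in> regions D" for R
      using some[OF that] that assms in_components_subset[of R "- curve D"]
      by (auto simp: point_coloring_def regions_def)
    then show ?thesis by (auto simp: \<kappa>_def)
  qed
  moreover have "crossing_rule w (curve D) (pointwise D \<kappa>) q \<longleftrightarrow> crossing_rule w (curve D) c q" for w q
    using p by (rule crossing_rule_cong)
  ultimately show "\<kappa> \<in> colorings A f v D"
    using assms by (simp add: colorings_def point_coloring_def colored_crossing_iff)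
qed

lemma coloring_eqI:
  assumes "\<kappa> \<in> colorings A f v D" "\<mu> \<in> colorings A f v D"
    and "\<And>z. z \<notin> curve D \<Longrightarrow> pointwise D \<kappa> z = pointwise D \<mu> z"
  shows "\<kappa> = \<mu>"
proof (rule PiE_ext)
  show "\<kappa> \<in> regions D \<rightarrow>\<^sub>E A" "\<mu> \<in> regions D \<rightarrow>\<^sub>E A" using assms by (auto simp: colorings_def)
  fix R assume "R \<in> regions D"
  then obtain z where "z \<notin> curve D" "R = connected_component_set (- curve D) z"
    by (auto simp: regions_def components_def)
  then show "\<kappa> R = \<mu> R" using assms(3)[of z] by (simp add: pointwise_def)
qed

text \<open>\<open>R\<close> is a relation because the new point coloring comes from an existence
  statement and may take any values on its curve. Injectivity is accordingly required only up to
  values on the curves.\<close>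

lemma colorings_lepollI:
  assumes ex: "\<And>c. point_coloring A f v D c \<Longrightarrow> \<exists>c'. point_coloring A f v D' c' \<and> R c c'"
    and inj: "\<And>c d c' d' z. point_coloring A f v D c \<Longrightarrow> point_coloring A f v D d \<Longrightarrow> R c c' \<Longrightarrow> R d d' \<Longrightarrow>
      (\<And>z. z \<notin> curve D' \<Longrightarrow> c' z = d' z) \<Longrightarrow> z \<notin> curve D \<Longrightarrow> c z = d z"
  shows "colorings A f v D \<lesssim> colorings A f v D'"
proof (rule lepoll_relational_full)
  let ?S = "\<lambda>\<kappa>' \<kappa>. \<exists>c'. R (pointwise D \<kappa>) c' \<and> (\<forall>z. z \<notin> curve D' \<longrightarrow> pointwise D' \<kappa>' z = c' z)"
  show "\<exists>\<kappa>'. \<kappa>' \<in> colorings A f v D' \<and> ?S \<kappa>' \<kappa>" if \<kappa>: "\<kappa> \<in> colorings A f v D" for \<kappa>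
  proof -
    obtain c' where c': "point_coloring A f v D' c'" "R (pointwise D \<kappa>) c'"
      using ex[OF point_coloring_pointwise[OF \<kappa>]] by blast
    then show ?thesis using coloring_of_point_coloring[OF c'(1)] by metis
  qed
  show "\<kappa> = \<mu>" if kappa: "\<kappa>' \<in> colorings A f v D'" "\<kappa> \<in> colorings A f v D" "\<mu> \<in> colorings A f v D"
    "?S \<kappa>' \<kappa>" "?S \<kappa>' \<mu>" for \<kappa>' \<kappa> \<mu>
  proof (rule coloring_eqI[OF kappa(2,3)])
    fix z assume z: "z \<notin> curve D"
    obtain c' where c: "R (pointwise D \<kappa>) c'" "\<And>z. z \<notin> curve D' \<Longrightarrow> pointwise D' \<kappa>' z = c' z"
      using kappa(4) by blast
    obtain d' where d: "R (pointwise D \<mu>) d'" "\<And>z. z \<notin> curve D' \<Longrightarrow> pointwise D' \<kappa>' z = d' z"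
      using kappa(5) by blast
    show "pointwise D \<kappa> z = pointwise D \<mu> z"
    proof (rule inj[OF point_coloring_pointwise[OF kappa(2)] point_coloring_pointwise[OF kappa(3)] c(1) d(1)])
      show "c' z = d' z" if "z \<notin> curve D'" for z
        using c(2)[OF that] d(2)[OF that] by simp
    qed (rule z)
  qed
qed

section \<open>Transport along homeomorphisms of the plane\<close>

definition map_diagram :: "(complex \<Rightarrow> complex) \<Rightarrow> diagram \<Rightarrow> diagram" where
  "map_diagram h D = \<lparr>curve = h ` curve D, flat_crossings = h ` flat_crossings D,
     virtual_crossings = h ` virtual_crossings D\<rparr>"

lemma map_diagram_simps [simp]:
  "curve (map_diagram h D) = h ` curve D" "flat_crossings (map_diagram h D) = h ` flat_crossings D"
  "virtual_crossings (map_diagram h D) = h ` virtual_crossings D"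
  by (simp_all add: map_diagram_def)

lemma local_chart_homeomorphism:
  assumes "local_chart M X p \<phi>" and h: "homeomorphism UNIV UNIV h g"
  shows "local_chart M (h ` X) (h p) (h \<circ> \<phi>)"
proof -
  let ?B = "ball (0::complex) 1"
  obtain \<psi> where \<psi>: "homeomorphism ?B (\<phi> ` ?B) \<phi> \<psi>"
    and 1: "\<phi> 0 = p" "open (\<phi> ` ?B)" "\<And>z. z \<in> ?B \<Longrightarrow> \<phi> z \<in> X \<longleftrightarrow> z \<in> M"
    using assms(1) by (auto simp: local_chart_def)
  have "homeomorphism (\<phi> ` ?B) (h ` \<phi> ` ?B) h g"
    using homeomorphism_of_subsets[OF h] by auto
  then have "homeomorphism ?B ((h \<circ> \<phi>) ` ?B) (h \<circ> \<phi>) (\<psi> \<circ> g)"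
    using homeomorphism_compose[OF \<psi>] by (simp add: image_comp)
  moreover have "open ((h \<circ> \<phi>) ` ?B)"
    using homeomorphism_open_image[OF h _ _ _ 1(2)] by (simp add: image_comp)
  moreover have "inj h" using h by (metis homeomorphism_def inj_on_inverseI UNIV_I)
  ultimately show ?thesis
    using 1 by (auto simp: local_chart_def inj_image_mem_iff)
qed

lemma map_diagram_inverse:
  assumes "homeomorphism UNIV UNIV h g"
  shows "map_diagram g (map_diagram h D) = D"
proof -
  have "g (h z) = z" for z using assms by (simp add: homeomorphism_def)
  then have "g ` h ` S = S" for S by (simp add: image_comp comp_def)
  then show ?thesis by (simp add: map_diagram_def)
qed

text \<open>The coloring \<open>c\<close> becomes \<open>c \<circ> g\<close>. Since the rule ranges
  over all charts, a chart \<phi> of the image is simply pulled back to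
  \<open>g \<circ> \<phi>\<close>. Reflections of the plane are included, which is used later for
  \<open>cnj\<close>.\<close>

lemma colorings_map_lepoll:
  assumes h: "homeomorphism UNIV UNIV h g"
  shows "colorings A f v D \<lesssim> colorings A f v (map_diagram h D)"
proof (rule colorings_lepollI[where R = "\<lambda>c c'. c' = c \<circ> g"])
  have gh: "g (h z) = z" "h (g z) = z" for z using h by (auto simp: homeomorphism_def)
  have gh': "g ` h ` S = S" for S using gh by (simp add: image_comp comp_def)
  have gX: "g z \<notin> curve D" if "z \<notin> h ` curve D" for z
    using that gh(2)[of z] imageI[of "g z" "curve D" h] by auto
  have rule: "crossing_rule w (h ` X) (c \<circ> g) (h p)" if "crossing_rule w X c p" for w X p and c :: "complex \<Rightarrow> 'a"
    unfolding crossing_rule_def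
  proof (intro allI impI)
    fix \<phi> assume "local_chart cross_model (h ` X) (h p) \<phi>"
    then have "local_chart cross_model (g ` h ` X) (g (h p)) (g \<circ> \<phi>)"
      using local_chart_homeomorphism homeomorphism_symD[OF h] by blast
    then have "local_chart cross_model X p (g \<circ> \<phi>)" by (simp only: gh gh')
    then have "crossing_equation w c (g \<circ> \<phi>)"
      using that by (simp add: crossing_rule_def)
    then show "crossing_equation w (c \<circ> g) \<phi>"
      by (simp add: crossing_equation_def)
  qed
  have const: "constant_off (h ` curve D) (c \<circ> g)" if "constant_off (curve D) c" for c :: "complex \<Rightarrow> 'a"
    unfolding constant_off_def
  proof (intro allI impI, elim conjE)
    fix C z w assume C: "connected C" "C \<inter> h ` curve D = {}" "z \<in> C" "w \<in> C"
    have "connected (g ` C)"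
      using C(1) h by (intro connected_continuous_image) (auto simp: homeomorphism_def intro: continuous_on_subset)
    moreover have "g ` C \<inter> curve D = {}" using C(2) gX by blast
    ultimately show "(c \<circ> g) z = (c \<circ> g) w"
      using constant_offD[OF that, of "g ` C"] C(3,4) by simp
  qed
  show "\<exists>c'. point_coloring A f v (map_diagram h D) c' \<and> c' = c \<circ> g" if "point_coloring A f v D c" for c
    using that gX by (auto simp: point_coloring_def intro!: rule const)
  show "c z = d z" if "c' = c \<circ> g" "d' = d \<circ> g" "\<And>z. z \<notin> curve (map_diagram h D) \<Longrightarrow> c' z = d' z"
    "z \<notin> curve D" for c d c' d' :: "complex \<Rightarrow> 'a" and z
  proof -
    have "h z \<notin> h ` curve D" using that(4) gh by (metis imageE)
    then show ?thesis using that(3)[of "h z"] that(1,2) gh by simp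
  qed
qed

lemma colorings_map_eqpoll:
  assumes h: "homeomorphism UNIV UNIV h g"
  shows "colorings A f v D \<approx> colorings A f v (map_diagram h D)"
  using colorings_map_lepoll[OF homeomorphism_symD[OF h], of A f v "map_diagram h D"]
  by (intro lepoll_antisym colorings_map_lepoll[OF h]) (simp add: map_diagram_inverse[OF h])

text \<open>The end map \<open>H 1\<close> is a homeomorphism of the plane that carries
  \<open>D\<close> with its crossings to \<open>D'\<close>, so this is an instance of
  transport.\<close>

lemma colorings_planar_isotopic:
  assumes "planar_isotopic D D'"
  shows "colorings A f v D \<approx> colorings A f v D'"
proof -
  obtain H :: "real \<Rightarrow> complex \<Rightarrow> complex" and g where "homeomorphism UNIV UNIV (H 1) g"
    and "D' = map_diagram (H 1) D"
    using assms unfolding planar_isotopic_def map_diagram_def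
    by (metis (full_types) diagram.surjective atLeastAtMost_iff order_refl zero_le_one old.unit.exhaust)
  then show ?thesis using colorings_map_eqpoll by blast
qed

section \<open>Replacing the inside of the square\<close>

definition square_boundary :: "complex set" where
  "square_boundary = {z \<in> square. \<bar>Re z\<bar> = 1 \<or> \<bar>Im z\<bar> = 1}"

abbreviation "square_interior \<equiv> {z. \<bar>Re z\<bar> < 1 \<and> \<bar>Im z\<bar> < 1}"

text \<open>Neighbourhoods are cut off by the square, so that its sides are included; there the
  condition is one-sided and is to be glued to the coloring outside.\<close>

definition locally_constant_on_square :: "complex set \<Rightarrow> (complex \<Rightarrow> 'a) \<Rightarrow> bool" where
  "locally_constant_on_square T e \<longleftrightarrow>
     (\<forall>z \<in> square - T. \<exists>U. open U \<and> z \<in> U \<and> (\<forall>w \<in> U \<inter> square. e w = e z))"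

text \<open>One chart suffices by \<open>crossing_ruleI\<close>. Keeping its image inside the open
  square makes it a chart of every diagram that contains the tangle.\<close>

definition tangle_crossing ::
    "('a \<Rightarrow> 'a \<Rightarrow> 'a \<Rightarrow> 'a) \<Rightarrow> complex set \<Rightarrow> (complex \<Rightarrow> 'a) \<Rightarrow> complex \<Rightarrow> bool" where
  "tangle_crossing f T e p \<longleftrightarrow>
     (\<exists>\<phi>. local_chart cross_model T p \<phi> \<and> \<phi> ` ball 0 1 \<subseteq> square_interior \<and> crossing_equation f e \<phi>)"

lemma closed_square: "closed square"
proof -
  have *: "square = {z. \<bar>Re z\<bar> \<le> 1} \<inter> {z. \<bar>Im z\<bar> \<le> 1}" by (auto simp: square_def)
  show ?thesis unfolding * by (intro closed_Int closed_Collect_le continuous_intros)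
qed

lemma open_square_interior: "open square_interior"
  by (intro open_Collect_conj open_Collect_less continuous_intros)

text \<open>The cross is invariant under scaling, so precomposition with a small factor
  \<open>r\<close> gives a chart again. Its image lies in \<open>U\<close>, where the two curves
  coincide, so it is a chart for both.\<close>

lemma local_chart_rescale:
  assumes \<phi>: "local_chart cross_model X p \<phi>" and U: "open U" "p \<in> U" "X \<inter> U = X' \<inter> U"
  obtains r where "0 < r" "r \<le> 1" "local_chart cross_model X p (\<lambda>z. \<phi> (complex_of_real r * z))"
    "local_chart cross_model X' p (\<lambda>z. \<phi> (complex_of_real r * z))"
    "(\<lambda>z. \<phi> (complex_of_real r * z)) ` ball 0 1 \<subseteq> U"
proof -
  let ?B = "ball (0::complex) 1"
  obtain \<psi> where \<psi>: "homeomorphism ?B (\<phi> ` ?B) \<phi> \<psi>"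
    and 1: "\<phi> 0 = p" "open (\<phi> ` ?B)" "\<And>z. z \<in> ?B \<Longrightarrow> \<phi> z \<in> X \<longleftrightarrow> z \<in> cross_model"
    using \<phi> by (auto simp: local_chart_def)
  have "continuous_on ?B \<phi>" using \<psi> by (simp add: homeomorphism_def)
  then have "open (\<phi> -` U \<inter> ?B)"
    using continuous_on_open_vimage[of ?B \<phi>] U(1) by blast
  moreover have "0 \<in> \<phi> -` U \<inter> ?B" using 1(1) U(2) by auto
  ultimately obtain r where r: "0 < r" "ball 0 r \<subseteq> \<phi> -` U \<inter> ?B" by (meson openE)
  define m where "m = (\<lambda>z::complex. complex_of_real r * z)"
  have mB: "m ` ?B = ball 0 r"
  proof -
    have "z \<in> m ` ?B" if "z \<in> ball 0 r" for z
      using that r(1) by (intro image_eqI[of _ _ "z / r"]) (auto simp: m_def norm_divide)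
    then show ?thesis using r(1) by (auto simp: m_def norm_mult)
  qed
  have r1: "r \<le> 1" using r by (auto simp: ball_subset_ball_iff)
  have hm: "homeomorphism ?B (ball 0 r) m (\<lambda>z. z / r)"
    using r(1) mB by (intro homeomorphismI) (auto intro!: continuous_intros simp: m_def norm_divide)
  have h: "homeomorphism (ball 0 r) (\<phi> ` ball 0 r) \<phi> \<psi>"
    using homeomorphism_of_subsets[OF \<psi>] r(2) by blast
  have im: "(\<phi> \<circ> m) ` ?B = \<phi> ` ball 0 r" by (metis image_comp mB)
  have *: "homeomorphism ?B ((\<phi> \<circ> m) ` ?B) (\<phi> \<circ> m) ((\<lambda>z. z / r) \<circ> \<psi>)"
    unfolding im by (rule homeomorphism_compose[OF hm h])
  have o: "open ((\<phi> \<circ> m) ` ?B)"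
    unfolding im using homeomorphism_open_image[OF \<psi> _ 1(2)] r(2) by simp
  have X: "\<phi> (m z) \<in> X \<longleftrightarrow> z \<in> cross_model" "\<phi> (m z) \<in> U" if "z \<in> ?B" for z
  proof -
    have "m z \<in> ball 0 r" using that mB by blast
    then show "\<phi> (m z) \<in> X \<longleftrightarrow> z \<in> cross_model" "\<phi> (m z) \<in> U"
      using 1(3)[of "m z"] r by (auto simp: m_def cross_model_def)
  qed
  have "local_chart cross_model X p (\<phi> \<circ> m)"
    using * o X 1(1) by (auto simp: local_chart_def m_def)
  moreover have "\<phi> (m z) \<in> X' \<longleftrightarrow> z \<in> cross_model" if "z \<in> ?B" for z
    using X[OF that] U(3) by blast
  then have "local_chart cross_model X' p (\<phi> \<circ> m)"
    using * o 1(1) by (auto simp: local_chart_def m_def)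
  moreover have "(\<phi> \<circ> m) ` ?B \<subseteq> U" using X(2) by auto
  ultimately show ?thesis
    using that[OF r(1) r1] by (simp add: m_def comp_def)
qed

text \<open>A given chart may leave \<open>U\<close>, beyond which the two colorings are unrelated.
  Shrunk into \<open>U\<close> it is a chart of both curves with the same equation, and
  \<open>crossing_equation_chart_change\<close> leads back to the given chart.\<close>

lemma crossing_rule_transfer:
  assumes K: "knot_theoretic_ternary_group A f"
    and c: "constant_off X c" "\<And>z. z \<notin> X \<Longrightarrow> c z \<in> A"
    and c': "constant_off X' c'" "\<And>z. z \<notin> X' \<Longrightarrow> c' z \<in> A"
    and U: "open U" "p \<in> U" "X \<inter> U = X' \<inter> U" "\<And>z. z \<in> U \<Longrightarrow> c' z = c z"
    and rule: "crossing_rule f X c p"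
  shows "crossing_rule f X' c' p"
  unfolding crossing_rule_def
proof (intro allI impI)
  fix \<phi> assume \<phi>: "local_chart cross_model X' p \<phi>"
  obtain r where r: "local_chart cross_model X' p (\<lambda>z. \<phi> (complex_of_real r * z))"
    "local_chart cross_model X p (\<lambda>z. \<phi> (complex_of_real r * z))"
    "(\<lambda>z. \<phi> (complex_of_real r * z)) ` ball 0 1 \<subseteq> U"
    using local_chart_rescale[OF \<phi> U(1,2) U(3)[symmetric]] by metis
  have "quadrant 1 q \<subseteq> ball 0 1" for q by (auto simp: quadrant_def)
  then have "c' (\<phi> (complex_of_real r * z)) = c (\<phi> (complex_of_real r * z))" if "z \<in> quadrant 1 q" for z q
    using that r(3) by (intro U(4)) blast
  then have eq: "crossing_equation f c' (\<lambda>z. \<phi> (complex_of_real r * z)) \<longleftrightarrow>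
      crossing_equation f c (\<lambda>z. \<phi> (complex_of_real r * z))"
    unfolding crossing_equation_def using corner_quadrant by metis
  show "crossing_equation f c' \<phi>"
    using crossing_equation_chart_change[OF K c' \<phi> r(1)] eq rule r(2) by (simp add: crossing_rule_def)
qed

lemma constant_off_neighbourhood:
  assumes "closed X" "constant_off X c" "z \<notin> X"
  obtains U where "open U" "z \<in> U" "U \<inter> X = {}" "\<And>w. w \<in> U \<Longrightarrow> c w = c z"
proof -
  obtain e where e: "0 < e" "ball z e \<subseteq> - X"
    using assms(1,3) by (meson openE open_Compl ComplI)
  show ?thesis
  proof (rule that)
    show "open (ball z e)" "z \<in> ball z e" "ball z e \<inter> X = {}" using e by auto
    then show "c w = c z" if "w \<in> ball z e" for w
      using constant_offD[OF assms(2) connected_ball] that by blast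
  qed
qed

lemma constant_off_locally:
  assumes "\<And>z. z \<notin> X \<Longrightarrow> \<exists>U. open U \<and> z \<in> U \<and> (\<forall>w\<in>U. c w = c z)"
  shows "constant_off X c"
  unfolding constant_off_def
proof (intro allI impI, elim conjE)
  fix C z w assume C: "connected C" "C \<inter> X = {}" "z \<in> C" "w \<in> C"
  show "c z = c w"
  proof (rule connected_local_const[OF C(1,3,4)], rule ballI)
    fix a assume "a \<in> C"
    then obtain U where "open U" "a \<in> U" "\<forall>w\<in>U. c w = c a" using C(2) assms[of a] by blast
    then show "\<forall>\<^sub>F b in at a within C. c a = c b"
      unfolding eventually_at_topological by metis
  qed
qed

lemma local_chart_in_square:
  assumes "local_chart cross_model T p \<phi>" "\<phi> ` ball 0 1 \<subseteq> square_interior" "X \<inter> square = T"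
  shows "local_chart cross_model X p \<phi>"
proof -
  have "\<phi> z \<in> X \<longleftrightarrow> \<phi> z \<in> T" if "z \<in> ball 0 1" for z
    using assms(2,3) that by (fastforce simp: square_def)
  then show ?thesis using assms(1) by (auto simp: local_chart_def)
qed

text \<open>No regularity of the curve at the end points of the tangle is needed: local constancy at a
  point of the boundary of the square follows from the old coloring outside and the new
  one inside, which agree at that point.\<close>

lemma point_coloring_replace:
  assumes K: "knot_theoretic_ternary_group A f" and L: "knot_theoretic_ternary_group A v"
    and X: "closed (curve D)" "closed (curve D')"
    and D': "curve D' \<inter> square = curve T'" "flat_crossings D' \<inter> square = flat_crossings T'"
      "virtual_crossings D' \<inter> square = virtual_crossings T'"
    and out: "agree_outside square D D'"
    and c: "point_coloring A f v D c"
    and e: "locally_constant_on_square (curve T') e" "\<And>z. z \<in> square \<Longrightarrow> e z \<in> A"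
      "\<And>z. z \<in> square_boundary - curve T' \<Longrightarrow> z \<notin> curve D \<and> e z = c z"
    and crossings: "\<forall>p\<in>flat_crossings T'. tangle_crossing f (curve T') e p"
      "\<forall>p\<in>virtual_crossings T'. tangle_crossing v (curve T') e p"
  shows "point_coloring A f v D' (\<lambda>z. if z \<in> square then e z else c z)" (is "point_coloring A f v D' ?c")
proof -
  have cA: "\<And>z. z \<notin> curve D \<Longrightarrow> c z \<in> A" and cc: "constant_off (curve D) c"
    using c by (auto simp: point_coloring_def)
  have XX: "z \<in> curve D' \<longleftrightarrow> z \<in> curve D" if "z \<notin> square" for z
    using out that by (auto simp: agree_outside_def)
  have A': "?c z \<in> A" if "z \<notin> curve D'" for z
    using that e(2) cA XX by auto
  have const: "constant_off (curve D') ?c"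
  proof (rule constant_off_locally)
    fix z assume z: "z \<notin> curve D'"
    show "\<exists>U. open U \<and> z \<in> U \<and> (\<forall>w\<in>U. ?c w = ?c z)"
    proof (cases "z \<in> square")
      case False
      obtain U where U: "open U" "z \<in> U" "\<And>w. w \<in> U \<Longrightarrow> c w = c z"
        using constant_off_neighbourhood[OF X(1) cc] XX[OF False] z by metis
      have "?c w = ?c z" if "w \<in> U - square" for w
        using that False U(3)[of w] by simp
      moreover have "open (U - square)" "z \<in> U - square"
        using U(1,2) False closed_square by (auto simp: open_Diff)
      ultimately show ?thesis by blast
    next
      case True
      then have "z \<in> square - curve T'" using D'(1) z by blast
      then obtain U where U: "open U" "z \<in> U" "\<And>w. w \<in> U \<inter> square \<Longrightarrow> e w = e z"
        using e(1)[unfolded locally_constant_on_square_def] by meson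
      show ?thesis
      proof (cases "z \<in> square_boundary")
        case False
        then have z': "z \<in> square_interior" using True by (auto simp: square_boundary_def square_def)
        have "?c w = ?c z" if "w \<in> U \<inter> square_interior" for w
          using that True U(3)[of w] by (simp add: square_def)
        moreover have "open (U \<inter> square_interior)" "z \<in> U \<inter> square_interior"
          using U(1,2) z' open_square_interior by auto
        ultimately show ?thesis by blast
      next
        case b: True
        then have "z \<notin> curve D" "e z = c z" using e(3)[of z] z D'(1) by auto
        obtain V where V: "open V" "z \<in> V" "\<And>w. w \<in> V \<Longrightarrow> c w = c z"
          by (rule constant_off_neighbourhood[OF X(1) cc \<open>z \<notin> curve D\<close>], rule that)
        have "?c w = ?c z" if "w \<in> U \<inter> V" for w
          using that True U(3)[of w] V(3)[of w] \<open>e z = c z\<close> by simp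
        moreover have "open (U \<inter> V)" "z \<in> U \<inter> V" using U(1,2) V(1,2) by auto
        ultimately show ?thesis by blast
      qed
    qed
  qed
  have outer: "crossing_rule w (curve D') ?c p"
    if "knot_theoretic_ternary_group A w" "crossing_rule w (curve D) c p" "p \<notin> square" for w p
    by (rule crossing_rule_transfer[OF that(1) cc cA const A' _ _ _ _ that(2), of "- square"])
      (use closed_square that(3) XX in \<open>auto simp: open_Compl\<close>)
  have inner: "crossing_rule w (curve D') ?c p"
    if w: "knot_theoretic_ternary_group A w" and p: "tangle_crossing w (curve T') e p" for w p
  proof -
    obtain \<phi> where \<phi>: "local_chart cross_model (curve T') p \<phi>" "\<phi> ` ball 0 1 \<subseteq> square_interior"
      "crossing_equation w e \<phi>"
      using p by (auto simp: tangle_crossing_def)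
    have "\<phi> z \<in> square" if "z \<in> quadrant 1 q" for z q
      using \<phi>(2) that by (fastforce simp: quadrant_def square_def)
    then have *: "?c (\<phi> z) = e (\<phi> z)" if "z \<in> quadrant 1 q" for z q
      using that by simp
    have "crossing_equation w ?c \<phi>"
      using \<phi>(3) unfolding crossing_equation_def *[OF corner_quadrant(1)]
        *[OF corner_quadrant(2)] *[OF corner_quadrant(3)] *[OF corner_quadrant(4)] .
    then show ?thesis
      using crossing_ruleI[OF w const A' local_chart_in_square[OF \<phi>(1,2) D'(1)]] by blast
  qed
  have "crossing_rule f (curve D') ?c p" if "p \<in> flat_crossings D'" for p
  proof (cases "p \<in> square")
    case True
    then show ?thesis using inner[OF K] crossings(1) D'(2) that by blast
  next
    case False
    then have "p \<in> flat_crossings D" using out that by (auto simp: agree_outside_def)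
    then show ?thesis using outer[OF K _ False] c by (simp add: point_coloring_def)
  qed
  moreover have "crossing_rule v (curve D') ?c p" if "p \<in> virtual_crossings D'" for p
  proof (cases "p \<in> square")
    case True
    then show ?thesis using inner[OF L] crossings(2) D'(3) that by blast
  next
    case False
    then have "p \<in> virtual_crossings D" using out that by (auto simp: agree_outside_def)
    then show ?thesis using outer[OF L _ False] c by (simp add: point_coloring_def)
  qed
  ultimately show ?thesis
    using A' const by (simp add: point_coloring_def)
qed

text \<open>A move in the standard square itself. Closedness is included because local constancy is
  argued with neighbourhoods that avoid the curve.\<close>

definition tangle_replacement :: "diagram \<Rightarrow> diagram \<Rightarrow> diagram \<Rightarrow> diagram \<Rightarrow> bool" where
  "tangle_replacement T T' D D' \<longleftrightarrow>
     closed (curve D) \<and> closed (curve D') \<and>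
     contains_tangle id T D \<and> contains_tangle id T' D' \<and> agree_outside square D D'"

lemma tangle_replacement_sym:
  "tangle_replacement T T' D D' \<Longrightarrow> tangle_replacement T' T D' D"
  by (auto simp: tangle_replacement_def agree_outside_def)

text \<open>The new coloring keeps the old values outside the square and on its sides, and by
  \<open>determined\<close> these fix the old coloring inside as well. Thus \<open>ex\<close> is
  about the new tangle and \<open>determined\<close> about the old one.\<close>

lemma colorings_replacement_lepoll:
  assumes K: "knot_theoretic_ternary_group A f" and L: "knot_theoretic_ternary_group A v"
    and rep: "tangle_replacement T T' D D'"
    and boundary: "\<And>z. z \<in> square_boundary \<Longrightarrow> z \<in> curve T \<longleftrightarrow> z \<in> curve T'"
    and ex: "\<And>c. point_coloring A f v D c \<Longrightarrow>
      \<exists>e. locally_constant_on_square (curve T') e \<and> (\<forall>z\<in>square. e z \<in> A) \<and>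
        (\<forall>z\<in>square_boundary - curve T'. e z = c z) \<and>
        (\<forall>p\<in>flat_crossings T'. tangle_crossing f (curve T') e p) \<and>
        (\<forall>p\<in>virtual_crossings T'. tangle_crossing v (curve T') e p)"
    and determined: "\<And>c d z. point_coloring A f v D c \<Longrightarrow> point_coloring A f v D d \<Longrightarrow>
      (\<And>w. w \<in> square_boundary - curve T \<Longrightarrow> c w = d w) \<Longrightarrow> z \<in> square - curve T \<Longrightarrow> c z = d z"
  shows "colorings A f v D \<lesssim> colorings A f v D'"
proof (rule colorings_lepollI[where R = "\<lambda>c c'. \<forall>z. z \<notin> curve D \<longrightarrow> z \<notin> square \<or> z \<in> square_boundary \<longrightarrow> c' z = c z"])
  have X: "closed (curve D)" "closed (curve D')" and T: "curve D \<inter> square = curve T"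
    and T': "curve D' \<inter> square = curve T'" "flat_crossings D' \<inter> square = flat_crossings T'"
      "virtual_crossings D' \<inter> square = virtual_crossings T'"
    and out: "agree_outside square D D'"
    using rep by (auto simp: tangle_replacement_def contains_tangle_def)
  have sub: "square_boundary \<subseteq> square" by (auto simp: square_boundary_def)
  {
    fix c assume c: "point_coloring A f v D c"
    obtain e where e: "locally_constant_on_square (curve T') e" "\<And>z. z\<in>square \<Longrightarrow> e z \<in> A"
        "\<And>z. z\<in>square_boundary - curve T' \<Longrightarrow> e z = c z"
        "\<forall>p\<in>flat_crossings T'. tangle_crossing f (curve T') e p"
        "\<forall>p\<in>virtual_crossings T'. tangle_crossing v (curve T') e p"
      using ex[OF c] by meson
    have b: "z \<notin> curve D \<and> e z = c z" if "z\<in>square_boundary - curve T'" for z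
      using e(3)[OF that] that boundary[of z] T sub by blast
    have "point_coloring A f v D' (\<lambda>z. if z \<in> square then e z else c z)"
      by (rule point_coloring_replace[OF K L X T' out c e(1,2) b e(4,5)])
    moreover have "(if z \<in> square then e z else c z) = c z"
      if "z \<notin> curve D" "z \<notin> square \<or> z \<in> square_boundary" for z
    proof (cases "z \<in> square")
      case True
      then have "z \<in> square_boundary - curve T'" using that boundary[of z] T by blast
      then show ?thesis using e(3) by simp
    qed simp
    ultimately show "\<exists>c'. point_coloring A f v D' c' \<and>
        (\<forall>z. z \<notin> curve D \<longrightarrow> z \<notin> square \<or> z \<in> square_boundary \<longrightarrow> c' z = c z)"
      by (intro exI[of _ "\<lambda>z. if z \<in> square then e z else c z"]) blast
  }
  fix c d c' d' z
  assume c: "point_coloring A f v D c" and d: "point_coloring A f v D d"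
    and R: "\<forall>z. z \<notin> curve D \<longrightarrow> z \<notin> square \<or> z \<in> square_boundary \<longrightarrow> c' z = c z"
      "\<forall>z. z \<notin> curve D \<longrightarrow> z \<notin> square \<or> z \<in> square_boundary \<longrightarrow> d' z = d z"
    and eq: "\<And>z. z \<notin> curve D' \<Longrightarrow> c' z = d' z" and z: "z \<notin> curve D"
  have outer: "c w = d w" if w: "w \<notin> curve D" "w \<notin> square \<or> w \<in> square_boundary" for w
  proof -
    have "w \<notin> curve D'"
    proof (cases "w \<in> square")
      case True
      then show ?thesis using w boundary[of w] T T'(1) by blast
    next
      case False
      then show ?thesis using w(1) out by (auto simp: agree_outside_def)
    qed
    then show ?thesis using eq[of w] R w by metis
  qed
  show "c z = d z"
  proof (cases "z \<in> square")
    case True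
    show ?thesis
    proof (rule determined[OF c d])
      show "c w = d w" if "w \<in> square_boundary - curve T" for w
        using outer[of w] that sub T by blast
    qed (use True T z in blast)
  next
    case False
    then show ?thesis using outer z by blast
  qed
qed

text \<open>An open convex polygon given as data: connected and open by general lemmas, with
  membership unfolding to linear inequalities. A face can then be handled by naming a list.\<close>

definition halfplanes :: "(real \<times> real \<times> real) list \<Rightarrow> complex set" where
  "halfplanes hs = {z. \<forall>(a, b, d)\<in>set hs. a * Re z + b * Im z < d}"

lemma halfplanes_Cons: "halfplanes ((a, b, d) # hs) = halfplane a b d \<inter> halfplanes hs"
  by (auto simp: halfplanes_def halfplane_def)

lemma halfplanes_Nil: "halfplanes [] = UNIV"
  by (simp add: halfplanes_def)

lemma convex_halfplanes: "convex (halfplanes hs)"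
  by (induction hs) (auto simp: halfplanes_Nil halfplanes_Cons convex_Int convex_halfplane)

lemma open_halfplanes: "open (halfplanes hs)"
  by (induction hs) (auto simp: halfplanes_Nil halfplanes_Cons open_Int open_halfplane)

lemma convex_square: "convex square"
proof -
  have *: "square = cbox (Complex (-1) (-1)) (Complex 1 1)"
    by (auto simp: square_def in_cbox_complex_iff)
  show ?thesis unfolding * by (rule convex_box)
qed

lemma constant_off_halfplanes:
  assumes "constant_off X c" "X \<inter> square = T"
    and "\<And>z. z \<in> square \<Longrightarrow> z \<in> halfplanes hs \<Longrightarrow> z \<notin> T"
    and "z \<in> square" "z \<in> halfplanes hs" "w \<in> square" "w \<in> halfplanes hs"
  shows "c z = c w"
  using assms by (intro constant_offD[OF assms(1), of "halfplanes hs \<inter> square"])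
    (auto intro!: convex_connected convex_Int convex_halfplanes convex_square)

lemma locally_constant_on_squareI:
  assumes "\<And>z. z \<in> square - T \<Longrightarrow>
    \<exists>hs. z \<in> halfplanes hs \<and> (\<forall>w\<in>halfplanes hs \<inter> square. e w = e z)"
  shows "locally_constant_on_square T e"
  unfolding locally_constant_on_square_def using assms open_halfplanes by meson

text \<open>This is the real affine map \<open>p + Re z * u + Im z * w\<close>, written in
  coordinates so that later claims become linear arithmetic.\<close>

definition affine_chart :: "complex \<Rightarrow> complex \<Rightarrow> complex \<Rightarrow> complex \<Rightarrow> complex" where
  "affine_chart p u w z =
     Complex (Re p + Re z * Re u + Im z * Re w) (Im p + Re z * Im u + Im z * Im w)"

text \<open>The condition is imposed on a box rather than on the unit disk inside it, because a box
  is described by linear inequalities.\<close>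

definition affine_crossing :: "complex set \<Rightarrow> complex \<Rightarrow> complex \<Rightarrow> complex \<Rightarrow> bool" where
  "affine_crossing T p u w \<longleftrightarrow> Re u * Im w \<noteq> Im u * Re w \<and>
     (\<forall>a b. \<bar>a\<bar> < 1 \<longrightarrow> \<bar>b\<bar> < 1 \<longrightarrow>
       affine_chart p u w (Complex a b) \<in> square_interior \<and>
       (affine_chart p u w (Complex a b) \<in> T \<longleftrightarrow> a = 0 \<or> b = 0))"

text \<open>Cramer's rule, used to verify the inverse of an affine chart.\<close>

lemma cramer:
  fixes x y :: real
  assumes "d = a * b' - a' * b" "d \<noteq> 0"
  shows "(x * b' - y * b) * a / d + (a * y - a' * x) * b / d = x"
    and "(x * b' - y * b) * a' / d + (a * y - a' * x) * b' / d = y"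
proof -
  have "(x * b' - y * b) * a + (a * y - a' * x) * b = x * d"
    "(x * b' - y * b) * a' + (a * y - a' * x) * b' = y * d"
    by (simp_all add: assms(1) algebra_simps)
  then show "(x * b' - y * b) * a / d + (a * y - a' * x) * b / d = x"
    "(x * b' - y * b) * a' / d + (a * y - a' * x) * b' / d = y"
    using assms(2) by (simp_all flip: add_divide_distrib)
qed

lemma affine_crossing_chart:
  assumes "affine_crossing T p u w"
  shows "local_chart cross_model T p (affine_chart p u w)"
    and "affine_chart p u w ` ball 0 1 \<subseteq> square_interior"
proof -
  let ?\<phi> = "affine_chart p u w"
  let ?d = "Re u * Im w - Im u * Re w"
  let ?\<psi> = "\<lambda>z. Complex (((Re z - Re p) * Im w - (Im z - Im p) * Re w) / ?d)
    ((Re u * (Im z - Im p) - Im u * (Re z - Re p)) / ?d)"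
  have d: "?d \<noteq> 0" using assms by (simp add: affine_crossing_def)
  have "?\<psi> (?\<phi> z) = z" for z
  proof -
    have "((Re z * Re u + Im z * Re w) * Im w - (Re z * Im u + Im z * Im w) * Re w) = Re z * ?d"
      "(Re u * (Re z * Im u + Im z * Im w) - Im u * (Re z * Re u + Im z * Re w)) = Im z * ?d"
      by (simp_all add: algebra_simps)
    then show ?thesis
      using d by (simp add: affine_chart_def complex_eq_iff add.assoc)
  qed
  moreover have "?\<phi> (?\<psi> z) = z" for z
    by (simp add: affine_chart_def complex_eq_iff add.assoc
        cramer[OF refl d, of "Re z - Re p" "Im z - Im p"])
  moreover have "continuous_on UNIV ?\<phi>"
    unfolding affine_chart_def Complex_eq by (intro continuous_intros)
  moreover have "continuous_on UNIV ?\<psi>"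
    unfolding Complex_eq using d by (intro continuous_intros) simp_all
  ultimately have h: "homeomorphism UNIV UNIV ?\<phi> ?\<psi>"
    by (intro homeomorphismI) auto
  have ball: "\<bar>Re z\<bar> < 1" "\<bar>Im z\<bar> < 1" if "z \<in> ball 0 1" for z
    using that abs_Re_le_cmod[of z] abs_Im_le_cmod[of z] by auto
  have in_T: "?\<phi> z \<in> square_interior" "?\<phi> z \<in> T \<longleftrightarrow> z \<in> cross_model" if "z \<in> ball 0 1" for z
    using assms[unfolded affine_crossing_def, THEN conjunct2, rule_format, OF ball[OF that]]
    by (simp_all add: cross_model_def)
  have "homeomorphism (ball 0 1) (?\<phi> ` ball 0 1) ?\<phi> ?\<psi>"
    using homeomorphism_of_subsets[OF h] by auto
  moreover have "open (?\<phi> ` ball 0 1)"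
    using homeomorphism_open_image[OF h] by simp
  moreover have "?\<phi> 0 = p" by (simp add: affine_chart_def)
  ultimately show "local_chart cross_model T p ?\<phi>"
    using in_T(2) by (auto simp: local_chart_def)
  show "?\<phi> ` ball 0 1 \<subseteq> square_interior" using in_T(1) by blast
qed

text \<open>\<open>crossing_equation\<close> with the corner coordinates multiplied out, so that the
  explicit patterns below evaluate by simplification.\<close>

definition affine_equation ::
    "('a \<Rightarrow> 'a \<Rightarrow> 'a \<Rightarrow> 'a) \<Rightarrow> (complex \<Rightarrow> 'a) \<Rightarrow> complex \<Rightarrow> complex \<Rightarrow> complex \<Rightarrow> bool" where
  "affine_equation f c p u w \<longleftrightarrow>
     c (Complex (Re p + (Re u + Re w) / 2) (Im p + (Im u + Im w) / 2)) =
     f (c (Complex (Re p + (Re w - Re u) / 2) (Im p + (Im w - Im u) / 2)))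
       (c (Complex (Re p - (Re u + Re w) / 2) (Im p - (Im u + Im w) / 2)))
       (c (Complex (Re p + (Re u - Re w) / 2) (Im p + (Im u - Im w) / 2)))"

lemma affine_equation_iff:
  "crossing_equation f c (affine_chart p u w) \<longleftrightarrow> affine_equation f c p u w"
proof -
  have "affine_chart p u w (Complex (1/2) (1/2)) = Complex (Re p + (Re u + Re w) / 2) (Im p + (Im u + Im w) / 2)"
    "affine_chart p u w (Complex (-1/2) (1/2)) = Complex (Re p + (Re w - Re u) / 2) (Im p + (Im w - Im u) / 2)"
    "affine_chart p u w (Complex (-1/2) (-1/2)) = Complex (Re p - (Re u + Re w) / 2) (Im p - (Im u + Im w) / 2)"
    "affine_chart p u w (Complex (1/2) (-1/2)) = Complex (Re p + (Re u - Re w) / 2) (Im p + (Im u - Im w) / 2)"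
    by (simp_all add: affine_chart_def complex_eq_iff field_simps)
  then show ?thesis by (simp only: crossing_equation_def affine_equation_def)
qed

lemma crossing_rule_affine:
  assumes "crossing_rule f X c p" "X \<inter> square = T" "affine_crossing T p u w"
  shows "affine_equation f c p u w"
  using assms affine_crossing_chart[OF assms(3)] local_chart_in_square
  unfolding crossing_rule_def affine_equation_iff[symmetric] by blast

lemma tangle_crossing_affine:
  assumes "affine_crossing T p u w" "affine_equation f e p u w"
  shows "tangle_crossing f T e p"
  using affine_crossing_chart[OF assms(1)] assms(2) unfolding tangle_crossing_def affine_equation_iff[symmetric]
  by blast

section \<open>The faces of the tangles\<close>

abbreviation "north \<equiv> Complex 0 1"
abbreviation "south \<equiv> Complex 0 (-1)"
abbreviation "east \<equiv> Complex 1 0"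
abbreviation "west \<equiv> Complex (-1) 0"

lemmas tangle_simps = square_def square_boundary_def halfplanes_def strand_def kink_def
  parallel_strands_def bigon_def triangle_def

definition strand_pattern :: "'a \<Rightarrow> 'a \<Rightarrow> complex \<Rightarrow> 'a" where
  "strand_pattern n s z = (if Im z < - \<bar>Re z\<bar> then s else n)"

text \<open>The single color \<open>n\<close> serves the faces above and beside the kink, since they
  are joined over the top of the loop.\<close>

definition kink_pattern :: "'a \<Rightarrow> 'a \<Rightarrow> 'a \<Rightarrow> complex \<Rightarrow> 'a" where
  "kink_pattern n l s z =
     (if Im z < - \<bar>Re z\<bar> then s else if \<bar>Re z\<bar> < Im z \<and> Im z < 1/2 then l else n)"

definition parallel_pattern :: "'a \<Rightarrow> 'a \<Rightarrow> 'a \<Rightarrow> complex \<Rightarrow> 'a" where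
  "parallel_pattern n m s z = (if 1/2 < Im z then n else if Im z < -1/2 then s else m)"

definition bigon_pattern :: "'a \<Rightarrow> 'a \<Rightarrow> 'a \<Rightarrow> 'a \<Rightarrow> 'a \<Rightarrow> complex \<Rightarrow> 'a" where
  "bigon_pattern n m s w e z =
     (if \<bar>\<bar>Re z\<bar> - 1/2\<bar> < Im z then n else if Im z < - \<bar>\<bar>Re z\<bar> - 1/2\<bar> then s
      else if \<bar>Re z\<bar> < 1/2 then m else if Re z < 0 then w else e)"

text \<open>Only \<open>triangle 1\<close> gets a pattern; colors for \<open>triangle (-1)\<close>
  arise by composing with \<open>cnj\<close>.\<close>

definition triangle_pattern :: "'a \<Rightarrow> 'a \<Rightarrow> 'a \<Rightarrow> 'a \<Rightarrow> 'a \<Rightarrow> 'a \<Rightarrow> 'a \<Rightarrow> complex \<Rightarrow> 'a" where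
  "triangle_pattern t n wu wd s ed eu z =
     (if \<bar>Re z\<bar> < Im z then if (1 - \<bar>Re z\<bar>) / 2 < Im z then n else t
      else if Im z < - \<bar>Re z\<bar> then s
      else if Re z < 0 then if (1 - \<bar>Re z\<bar>) / 2 < Im z then wu else wd
      else if (1 - \<bar>Re z\<bar>) / 2 < Im z then eu else ed)"

text \<open>The face above the strand is not convex, but it is a union of two half-planes that both
  contain \<open>north\<close>. The later color lemmas treat nonconvex faces in the same
  manner.\<close>

lemma strand_color:
  assumes "constant_off X c" "X \<inter> square = strand" "z \<in> square - strand"
  shows "c z = strand_pattern (c north) (c south) z"
proof -
  note const = constant_off_halfplanes[OF assms(1,2)]
  have s: "c z = c south" if "Im z < - \<bar>Re z\<bar>"
    by (rule const[of "[(1, 1, 0), (-1, 1, 0)]"]) (use assms(3) that in \<open>auto simp: tangle_simps\<close>)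
  have n1: "c z = c north" if "- Re z < Im z"
    by (rule const[of "[(-1, -1, 0)]"]) (use assms(3) that in \<open>auto simp: tangle_simps\<close>)
  have n2: "c z = c north" if "Re z < Im z"
    by (rule const[of "[(1, -1, 0)]"]) (use assms(3) that in \<open>auto simp: tangle_simps\<close>)
  have "Im z \<noteq> - \<bar>Re z\<bar>" using assms(3) by (simp add: tangle_simps)
  then consider "Im z < - \<bar>Re z\<bar>" | "- \<bar>Re z\<bar> < Im z" "- Re z < Im z" | "- \<bar>Re z\<bar> < Im z" "Re z < Im z" by linarith
  then show ?thesis
    by cases (simp_all add: strand_pattern_def s n1 n2)
qed

lemma kink_color:
  assumes "constant_off X c" "X \<inter> square = kink" "z \<in> square - kink"
  shows "c z = kink_pattern (c north) (c (Complex 0 (1/4))) (c south) z"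
proof -
  note const = constant_off_halfplanes[OF assms(1,2)]
  have s: "c z = c south" if "Im z < - \<bar>Re z\<bar>"
    by (rule const[of "[(1, 1, 0), (-1, 1, 0)]"]) (use assms(3) that in \<open>auto simp: tangle_simps\<close>)
  have l: "c z = c (Complex 0 (1/4))" if "\<bar>Re z\<bar> < Im z" "Im z < 1/2"
    by (rule const[of "[(1, -1, 0), (-1, -1, 0), (0, 1, 1/2)]"]) (use assms(3) that in \<open>auto simp: tangle_simps\<close>)
  have n: "c w = c north" if "w \<in> square" "1/2 < Im w" for w
    by (rule const[of "[(0, -1, -1/2)]"]) (use that in \<open>auto simp: tangle_simps\<close>)
  \<comment> \<open>The point \<open>Complex 1 (3/4)\<close> lies in the eastern wedge and also
    above the loop, so it links the wedge to \<open>north\<close>. The western point does the same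
    on the other side.\<close>
  have e: "c z = c (Complex 1 (3/4))" if "\<bar>Im z\<bar> < Re z"
    by (rule const[of "[(-1, 1, 0), (-1, -1, 0)]"]) (use assms(3) that in \<open>auto simp: tangle_simps\<close>)
  have w: "c z = c (Complex (-1) (3/4))" if "\<bar>Im z\<bar> < - Re z"
    by (rule const[of "[(1, 1, 0), (1, -1, 0)]"]) (use assms(3) that in \<open>auto simp: tangle_simps\<close>)
  have e': "c (Complex 1 (3/4)) = c north" and w': "c (Complex (-1) (3/4)) = c north"
    by (auto intro!: n simp: square_def)
  have "\<not> (\<bar>Im z\<bar> = \<bar>Re z\<bar> \<and> Im z \<le> 1/2 \<or> Im z = 1/2 \<and> \<bar>Re z\<bar> \<le> 1/2)"
    using assms(3) by (simp add: tangle_simps)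
  then consider "Im z < - \<bar>Re z\<bar>" | "\<bar>Re z\<bar> < Im z" "Im z < 1/2" | "- \<bar>Re z\<bar> \<le> Im z" "1/2 < Im z"
    | "\<bar>Im z\<bar> < Re z" | "\<bar>Im z\<bar> < - Re z" by argo
  then show ?thesis
  proof cases
    case 2
    then have "\<not> Im z < - \<bar>Re z\<bar>" by linarith
    then show ?thesis by (simp only: kink_pattern_def l[OF 2] 2 if_True if_False simp_thms)
  next
    case 3
    then show ?thesis using n[of z] assms(3) by (simp add: kink_pattern_def)
  next
    case 4
    then have "\<not> Im z < - \<bar>Re z\<bar>" "\<not> \<bar>Re z\<bar> < Im z" by linarith+
    then show ?thesis by (simp only: kink_pattern_def e[OF 4] e' if_False simp_thms)
  next
    case 5
    then have "\<not> Im z < - \<bar>Re z\<bar>" "\<not> \<bar>Re z\<bar> < Im z" by linarith+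
    then show ?thesis by (simp only: kink_pattern_def w[OF 5] w' if_False simp_thms)
  qed (simp_all add: kink_pattern_def s l)
qed

lemma parallel_color:
  assumes "constant_off X c" "X \<inter> square = parallel_strands" "z \<in> square - parallel_strands"
  shows "c z = parallel_pattern (c north) (c east) (c south) z" and "c west = c east"
proof -
  note const = constant_off_halfplanes[OF assms(1,2)]
  have n: "c z = c north" if "1/2 < Im z"
    by (rule const[of "[(0, -1, -1/2)]"]) (use assms(3) that in \<open>auto simp: tangle_simps\<close>)
  have s: "c z = c south" if "Im z < -1/2"
    by (rule const[of "[(0, 1, -1/2)]"]) (use assms(3) that in \<open>auto simp: tangle_simps\<close>)
  have m: "c w = c east" if "\<bar>Im w\<bar> < 1/2" "w \<in> square" for w
    by (rule const[of "[(0, 1, 1/2), (0, -1, 1/2)]"]) (use that in \<open>auto simp: tangle_simps\<close>)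
  show "c west = c east" by (rule m) (auto simp: square_def)
  have "\<bar>Im z\<bar> \<noteq> 1/2" using assms(3) by (simp add: tangle_simps)
  then consider "1/2 < Im z" | "Im z < -1/2" | "\<bar>Im z\<bar> < 1/2" by linarith
  then show "c z = parallel_pattern (c north) (c east) (c south) z"
  proof cases
    case 3
    then have "\<not> 1/2 < Im z" "\<not> Im z < -1/2" by linarith+
    moreover have "c z = c east" using m 3 assms(3) by blast
    ultimately show ?thesis by (simp only: parallel_pattern_def if_False)
  qed (simp_all add: parallel_pattern_def n s)
qed

lemma bigon_color:
  assumes "constant_off X c" "X \<inter> square = bigon" "z \<in> square - bigon"
  shows "c z = bigon_pattern (c north) (c 0) (c south) (c west) (c east) z"
proof -
  note const = constant_off_halfplanes[OF assms(1,2)]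
  \<comment> \<open>The northern face is bounded below by a W whose middle peak destroys convexity.
    Extending either slope of the peak gives a convex piece, and both pieces contain
    \<open>north\<close>. The southern face is treated likewise.\<close>
  have n1: "c z = c north" if "\<bar>Re z\<bar> - 1/2 < Im z" "1/2 - Re z < Im z"
    by (rule const[of "[(1, -1, 1/2), (-1, -1, 1/2), (-1, -1, -1/2)]"]) (use assms(3) that in \<open>auto simp: tangle_simps\<close>)
  have n2: "c z = c north" if "\<bar>Re z\<bar> - 1/2 < Im z" "1/2 + Re z < Im z"
    by (rule const[of "[(1, -1, 1/2), (-1, -1, 1/2), (1, -1, -1/2)]"]) (use assms(3) that in \<open>auto simp: tangle_simps\<close>)
  have s1: "c z = c south" if "Im z < 1/2 - \<bar>Re z\<bar>" "Im z < Re z - 1/2"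
    by (rule const[of "[(1, 1, 1/2), (-1, 1, 1/2), (-1, 1, -1/2)]"]) (use assms(3) that in \<open>auto simp: tangle_simps\<close>)
  have s2: "c z = c south" if "Im z < 1/2 - \<bar>Re z\<bar>" "Im z < - Re z - 1/2"
    by (rule const[of "[(1, 1, 1/2), (-1, 1, 1/2), (1, 1, -1/2)]"]) (use assms(3) that in \<open>auto simp: tangle_simps\<close>)
  have m: "c z = c 0" if "\<bar>Im z\<bar> < 1/2 - \<bar>Re z\<bar>"
    by (rule const[of "[(1, 1, 1/2), (-1, 1, 1/2), (1, -1, 1/2), (-1, -1, 1/2)]"]) (use assms(3) that in \<open>auto simp: tangle_simps\<close>)
  have w: "c z = c west" if "\<bar>Im z\<bar> < - Re z - 1/2"
    by (rule const[of "[(1, 1, -1/2), (1, -1, -1/2)]"]) (use assms(3) that in \<open>auto simp: tangle_simps\<close>)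
  have e: "c z = c east" if "\<bar>Im z\<bar> < Re z - 1/2"
    by (rule const[of "[(-1, 1, -1/2), (-1, -1, -1/2)]"]) (use assms(3) that in \<open>auto simp: tangle_simps\<close>)
  have "Im z \<noteq> \<bar>Re z\<bar> - 1/2" "Im z \<noteq> 1/2 - \<bar>Re z\<bar>" using assms(3) by (simp_all add: tangle_simps)
  then consider "\<bar>\<bar>Re z\<bar> - 1/2\<bar> < Im z" "\<bar>Re z\<bar> - 1/2 < Im z" "1/2 - Re z < Im z"
    | "\<bar>\<bar>Re z\<bar> - 1/2\<bar> < Im z" "\<bar>Re z\<bar> - 1/2 < Im z" "1/2 + Re z < Im z"
    | "Im z < - \<bar>\<bar>Re z\<bar> - 1/2\<bar>" "Im z < 1/2 - \<bar>Re z\<bar>" "Im z < Re z - 1/2"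
    | "Im z < - \<bar>\<bar>Re z\<bar> - 1/2\<bar>" "Im z < 1/2 - \<bar>Re z\<bar>" "Im z < - Re z - 1/2"
    | "\<bar>Im z\<bar> < 1/2 - \<bar>Re z\<bar>" | "\<bar>Im z\<bar> < - Re z - 1/2" | "\<bar>Im z\<bar> < Re z - 1/2" by argo
  then show ?thesis
  proof cases
    case 1
    show ?thesis by (simp only: bigon_pattern_def n1[OF 1(2,3)] 1(1) if_True)
  next
    case 2
    show ?thesis by (simp only: bigon_pattern_def n2[OF 2(2,3)] 2(1) if_True)
  next
    case 3
    then have "\<not> \<bar>\<bar>Re z\<bar> - 1/2\<bar> < Im z" by linarith
    then show ?thesis by (simp only: bigon_pattern_def s1[OF 3(2,3)] 3(1) if_True if_False)
  next
    case 4
    then have "\<not> \<bar>\<bar>Re z\<bar> - 1/2\<bar> < Im z" by linarith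
    then show ?thesis by (simp only: bigon_pattern_def s2[OF 4(2,3)] 4(1) if_True if_False)
  next
    case 5
    then have "\<not> \<bar>\<bar>Re z\<bar> - 1/2\<bar> < Im z" "\<not> Im z < - \<bar>\<bar>Re z\<bar> - 1/2\<bar>" "\<bar>Re z\<bar> < 1/2" by linarith+
    then show ?thesis by (simp only: bigon_pattern_def m[OF 5] if_True if_False)
  next
    case 6
    then have "\<not> \<bar>\<bar>Re z\<bar> - 1/2\<bar> < Im z" "\<not> Im z < - \<bar>\<bar>Re z\<bar> - 1/2\<bar>" "\<not> \<bar>Re z\<bar> < 1/2" "Re z < 0" by linarith+
    then show ?thesis by (simp only: bigon_pattern_def w[OF 6] if_True if_False)
  next
    case 7
    then have "\<not> \<bar>\<bar>Re z\<bar> - 1/2\<bar> < Im z" "\<not> Im z < - \<bar>\<bar>Re z\<bar> - 1/2\<bar>" "\<not> \<bar>Re z\<bar> < 1/2" "\<not> Re z < 0" by linarith+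
    then show ?thesis by (simp only: bigon_pattern_def e[OF 7] if_False)
  qed
qed

lemma triangle_color:
  assumes "constant_off X c" "X \<inter> square = triangle 1" "z \<in> square - triangle 1"
  shows "c z = triangle_pattern (c (Complex 0 (1/4))) (c north) (c (Complex (-1) (1/2)))
    (c (Complex (-1) (-1/2))) (c south) (c (Complex 1 (-1/2))) (c (Complex 1 (1/2))) z"
proof -
  note const = constant_off_halfplanes[OF assms(1,2)]
  \<comment> \<open>The third strand is a roof with its ridge on the imaginary axis; each slope,
    extended, bounds one convex piece of the northern face.\<close>
  have n1: "c z = c north" if "\<bar>Re z\<bar> < Im z" "(1 - Re z) / 2 < Im z"
    by (rule const[of "[(1, -1, 0), (-1, -1, 0), (-1, -2, -1)]"]) (use assms(3) that in \<open>auto simp: tangle_simps\<close>)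
  have n2: "c z = c north" if "\<bar>Re z\<bar> < Im z" "(1 + Re z) / 2 < Im z"
    by (rule const[of "[(1, -1, 0), (-1, -1, 0), (1, -2, -1)]"]) (use assms(3) that in \<open>auto simp: tangle_simps\<close>)
  have t: "c z = c (Complex 0 (1/4))" if "\<bar>Re z\<bar> < Im z" "Im z < (1 - \<bar>Re z\<bar>) / 2"
    by (rule const[of "[(1, -1, 0), (-1, -1, 0), (1, 2, 1), (-1, 2, 1)]"]) (use assms(3) that in \<open>auto simp: tangle_simps\<close>)
  have s: "c z = c south" if "Im z < - \<bar>Re z\<bar>"
    by (rule const[of "[(1, 1, 0), (-1, 1, 0)]"]) (use assms(3) that in \<open>auto simp: tangle_simps\<close>)
  have wu: "c z = c (Complex (-1) (1/2))" if "\<bar>Im z\<bar> < - Re z" "(1 - \<bar>Re z\<bar>) / 2 < Im z"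
    by (rule const[of "[(1, 1, 0), (1, -1, 0), (1, -2, -1)]"]) (use assms(3) that in \<open>auto simp: tangle_simps\<close>)
  have wd: "c z = c (Complex (-1) (-1/2))" if "\<bar>Im z\<bar> < - Re z" "Im z < (1 - \<bar>Re z\<bar>) / 2"
    by (rule const[of "[(1, 1, 0), (1, -1, 0), (-1, 2, 1)]"]) (use assms(3) that in \<open>auto simp: tangle_simps\<close>)
  have eu: "c z = c (Complex 1 (1/2))" if "\<bar>Im z\<bar> < Re z" "(1 - \<bar>Re z\<bar>) / 2 < Im z"
    by (rule const[of "[(-1, 1, 0), (-1, -1, 0), (-1, -2, -1)]"]) (use assms(3) that in \<open>auto simp: tangle_simps\<close>)
  have ed: "c z = c (Complex 1 (-1/2))" if "\<bar>Im z\<bar> < Re z" "Im z < (1 - \<bar>Re z\<bar>) / 2"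
    by (rule const[of "[(-1, 1, 0), (-1, -1, 0), (1, 2, 1)]"]) (use assms(3) that in \<open>auto simp: tangle_simps\<close>)
  have ne: "\<bar>Im z\<bar> \<noteq> \<bar>Re z\<bar>" "Im z \<noteq> (1 - \<bar>Re z\<bar>) / 2" using assms(3) by (simp_all add: tangle_simps)
  consider "\<bar>Re z\<bar> < Im z" | "Im z < - \<bar>Re z\<bar>" | "\<bar>Im z\<bar> < - Re z" | "\<bar>Im z\<bar> < Re z"
    using ne(1) by linarith
  then show ?thesis
  proof cases
    case 1
    have "(1 - \<bar>Re z\<bar>) / 2 = (1 - Re z) / 2 \<or> (1 - \<bar>Re z\<bar>) / 2 = (1 + Re z) / 2"
      by (cases "0 \<le> Re z") simp_all
    then consider "(1 - \<bar>Re z\<bar>) / 2 < Im z" "c z = c north"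
      | "\<not> (1 - \<bar>Re z\<bar>) / 2 < Im z" "c z = c (Complex 0 (1/4))"
      using ne(2) n1 n2 t 1 by (metis not_less_iff_gr_or_eq)
    then show ?thesis
      by cases (simp_all only: triangle_pattern_def 1 if_True if_False)
  next
    case 2
    then have "\<not> \<bar>Re z\<bar> < Im z" by linarith
    then show ?thesis by (simp only: triangle_pattern_def s[OF 2] 2 if_True if_False)
  next
    case 3
    then have "\<not> \<bar>Re z\<bar> < Im z" "\<not> Im z < - \<bar>Re z\<bar>" "Re z < 0" by linarith+
    then show ?thesis using wu[OF 3] wd[OF 3] ne(2)
      by (simp only: triangle_pattern_def if_True if_False) argo
  next
    case 4
    then have "\<not> \<bar>Re z\<bar> < Im z" "\<not> Im z < - \<bar>Re z\<bar>" "\<not> Re z < 0" by linarith+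
    then show ?thesis using eu[OF 4] ed[OF 4] ne(2)
      by (simp only: triangle_pattern_def if_True if_False) argo
  qed
qed

text \<open>The convex pieces from \<open>strand_color\<close> are open and serve as neighbourhoods.
  The other patterns reuse the pieces of their own color lemmas.\<close>

lemma strand_pattern_locally_constant: "locally_constant_on_square strand (strand_pattern n s)"
proof (rule locally_constant_on_squareI)
  fix z assume "z \<in> square - strand"
  then have "Im z < - \<bar>Re z\<bar> \<or> - Re z < Im z \<or> Re z < Im z" by (simp add: tangle_simps) linarith
  then show "\<exists>hs. z \<in> halfplanes hs \<and> (\<forall>w\<in>halfplanes hs \<inter> square. strand_pattern n s w = strand_pattern n s z)"
  proof (elim disjE)
    assume "Im z < - \<bar>Re z\<bar>"
    then show ?thesis
      by (intro exI[of _ "[(1, 1, 0), (-1, 1, 0)]"]) (auto simp: halfplanes_def strand_pattern_def)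
  next
    assume "- Re z < Im z"
    then show ?thesis
      by (intro exI[of _ "[(-1, -1, 0)]"]) (auto simp: halfplanes_def strand_pattern_def)
  next
    assume "Re z < Im z"
    then show ?thesis
      by (intro exI[of _ "[(1, -1, 0)]"]) (auto simp: halfplanes_def strand_pattern_def)
  qed
qed

lemma kink_pattern_locally_constant: "locally_constant_on_square kink (kink_pattern n l s)"
proof (rule locally_constant_on_squareI)
  fix z assume "z \<in> square - kink"
  then have "Im z < - \<bar>Re z\<bar> \<or> \<bar>Re z\<bar> < Im z \<and> Im z < 1/2 \<or> 1/2 < Im z \<or> \<bar>Im z\<bar> < Re z \<or> \<bar>Im z\<bar> < - Re z"
    by (simp add: tangle_simps) argo
  then show "\<exists>hs. z \<in> halfplanes hs \<and> (\<forall>w\<in>halfplanes hs \<inter> square. kink_pattern n l s w = kink_pattern n l s z)"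
  proof (elim disjE)
    assume "Im z < - \<bar>Re z\<bar>"
    then show ?thesis
      by (intro exI[of _ "[(1, 1, 0), (-1, 1, 0)]"]) (auto simp: halfplanes_def kink_pattern_def)
  next
    assume "\<bar>Re z\<bar> < Im z \<and> Im z < 1/2"
    then show ?thesis
      by (intro exI[of _ "[(1, -1, 0), (-1, -1, 0), (0, 1, 1/2)]"]) (auto simp: halfplanes_def kink_pattern_def)
  next
    assume "1/2 < Im z"
    then show ?thesis
      by (intro exI[of _ "[(0, -1, -1/2)]"]) (auto simp: halfplanes_def kink_pattern_def)
  next
    assume "\<bar>Im z\<bar> < Re z"
    then show ?thesis
      by (intro exI[of _ "[(-1, 1, 0), (-1, -1, 0)]"]) (auto simp: halfplanes_def kink_pattern_def)
  next
    assume "\<bar>Im z\<bar> < - Re z"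
    then show ?thesis
      by (intro exI[of _ "[(1, 1, 0), (1, -1, 0)]"]) (auto simp: halfplanes_def kink_pattern_def)
  qed
qed

lemma parallel_pattern_locally_constant: "locally_constant_on_square parallel_strands (parallel_pattern n m s)"
proof (rule locally_constant_on_squareI)
  fix z assume "z \<in> square - parallel_strands"
  then have "1/2 < Im z \<or> Im z < -1/2 \<or> \<bar>Im z\<bar> < 1/2" by (simp add: tangle_simps) linarith
  then show "\<exists>hs. z \<in> halfplanes hs \<and> (\<forall>w\<in>halfplanes hs \<inter> square. parallel_pattern n m s w = parallel_pattern n m s z)"
  proof (elim disjE)
    assume "1/2 < Im z"
    then show ?thesis
      by (intro exI[of _ "[(0, -1, -1/2)]"]) (auto simp: halfplanes_def parallel_pattern_def)
  next
    assume "Im z < -1/2"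
    then show ?thesis
      by (intro exI[of _ "[(0, 1, -1/2)]"]) (auto simp: halfplanes_def parallel_pattern_def)
  next
    assume "\<bar>Im z\<bar> < 1/2"
    then show ?thesis
      by (intro exI[of _ "[(0, 1, 1/2), (0, -1, 1/2)]"]) (auto simp: halfplanes_def parallel_pattern_def)
  qed
qed

lemma bigon_pattern_locally_constant: "locally_constant_on_square bigon (bigon_pattern n m s w e)"
proof (rule locally_constant_on_squareI)
  fix z assume "z \<in> square - bigon"
  then have "\<bar>Re z\<bar> - 1/2 < Im z \<and> 1/2 - Re z < Im z \<or> \<bar>Re z\<bar> - 1/2 < Im z \<and> 1/2 + Re z < Im z
    \<or> Im z < 1/2 - \<bar>Re z\<bar> \<and> Im z < Re z - 1/2 \<or> Im z < 1/2 - \<bar>Re z\<bar> \<and> Im z < - Re z - 1/2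
    \<or> \<bar>Im z\<bar> < 1/2 - \<bar>Re z\<bar> \<or> \<bar>Im z\<bar> < - Re z - 1/2 \<or> \<bar>Im z\<bar> < Re z - 1/2"
    by (simp add: tangle_simps) argo
  then show "\<exists>hs. z \<in> halfplanes hs \<and> (\<forall>x\<in>halfplanes hs \<inter> square. bigon_pattern n m s w e x = bigon_pattern n m s w e z)"
  proof (elim disjE)
    assume "\<bar>Re z\<bar> - 1/2 < Im z \<and> 1/2 - Re z < Im z"
    then show ?thesis
      by (intro exI[of _ "[(1, -1, 1/2), (-1, -1, 1/2), (-1, -1, -1/2)]"]) (auto simp: halfplanes_def bigon_pattern_def)
  next
    assume "\<bar>Re z\<bar> - 1/2 < Im z \<and> 1/2 + Re z < Im z"
    then show ?thesis
      by (intro exI[of _ "[(1, -1, 1/2), (-1, -1, 1/2), (1, -1, -1/2)]"]) (auto simp: halfplanes_def bigon_pattern_def)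
  next
    assume "Im z < 1/2 - \<bar>Re z\<bar> \<and> Im z < Re z - 1/2"
    then show ?thesis
      by (intro exI[of _ "[(1, 1, 1/2), (-1, 1, 1/2), (-1, 1, -1/2)]"]) (auto simp: halfplanes_def bigon_pattern_def)
  next
    assume "Im z < 1/2 - \<bar>Re z\<bar> \<and> Im z < - Re z - 1/2"
    then show ?thesis
      by (intro exI[of _ "[(1, 1, 1/2), (-1, 1, 1/2), (1, 1, -1/2)]"]) (auto simp: halfplanes_def bigon_pattern_def)
  next
    assume "\<bar>Im z\<bar> < 1/2 - \<bar>Re z\<bar>"
    then show ?thesis
      by (intro exI[of _ "[(1, 1, 1/2), (-1, 1, 1/2), (1, -1, 1/2), (-1, -1, 1/2)]"]) (auto simp: halfplanes_def bigon_pattern_def)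
  next
    assume "\<bar>Im z\<bar> < - Re z - 1/2"
    then show ?thesis
      by (intro exI[of _ "[(1, 1, -1/2), (1, -1, -1/2)]"]) (auto simp: halfplanes_def bigon_pattern_def)
  next
    assume "\<bar>Im z\<bar> < Re z - 1/2"
    then show ?thesis
      by (intro exI[of _ "[(-1, 1, -1/2), (-1, -1, -1/2)]"]) (auto simp: halfplanes_def bigon_pattern_def)
  qed
qed

lemma triangle_pattern_locally_constant:
  "locally_constant_on_square (triangle 1) (triangle_pattern t n wu wd s ed eu)"
proof (rule locally_constant_on_squareI)
  fix z assume "z \<in> square - triangle 1"
  then have ne: "\<bar>Im z\<bar> \<noteq> \<bar>Re z\<bar>" "Im z \<noteq> (1 - \<bar>Re z\<bar>) / 2" by (simp_all add: tangle_simps)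
  have "(1 - \<bar>Re z\<bar>) / 2 = (1 - Re z) / 2 \<or> (1 - \<bar>Re z\<bar>) / 2 = (1 + Re z) / 2"
    by (cases "0 \<le> Re z") simp_all
  then have "\<bar>Re z\<bar> < Im z \<and> (1 - Re z) / 2 < Im z \<or> \<bar>Re z\<bar> < Im z \<and> (1 + Re z) / 2 < Im z
    \<or> \<bar>Re z\<bar> < Im z \<and> Im z < (1 - \<bar>Re z\<bar>) / 2 \<or> Im z < - \<bar>Re z\<bar>
    \<or> \<bar>Im z\<bar> < - Re z \<and> (1 + Re z) / 2 < Im z \<or> \<bar>Im z\<bar> < - Re z \<and> Im z < (1 + Re z) / 2
    \<or> \<bar>Im z\<bar> < Re z \<and> (1 - Re z) / 2 < Im z \<or> \<bar>Im z\<bar> < Re z \<and> Im z < (1 - Re z) / 2"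
    using ne by argo
  then show "\<exists>hs. z \<in> halfplanes hs \<and> (\<forall>x\<in>halfplanes hs \<inter> square.
      triangle_pattern t n wu wd s ed eu x = triangle_pattern t n wu wd s ed eu z)"
  proof (elim disjE)
    assume "\<bar>Re z\<bar> < Im z \<and> (1 - Re z) / 2 < Im z"
    then show ?thesis
      by (intro exI[of _ "[(1, -1, 0), (-1, -1, 0), (-1, -2, -1)]"]) (auto simp: halfplanes_def triangle_pattern_def)
  next
    assume "\<bar>Re z\<bar> < Im z \<and> (1 + Re z) / 2 < Im z"
    then show ?thesis
      by (intro exI[of _ "[(1, -1, 0), (-1, -1, 0), (1, -2, -1)]"]) (auto simp: halfplanes_def triangle_pattern_def)
  next
    assume "\<bar>Re z\<bar> < Im z \<and> Im z < (1 - \<bar>Re z\<bar>) / 2"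
    then show ?thesis
      by (intro exI[of _ "[(1, -1, 0), (-1, -1, 0), (1, 2, 1), (-1, 2, 1)]"]) (auto simp: halfplanes_def triangle_pattern_def)
  next
    assume "Im z < - \<bar>Re z\<bar>"
    then show ?thesis
      by (intro exI[of _ "[(1, 1, 0), (-1, 1, 0)]"]) (auto simp: halfplanes_def triangle_pattern_def)
  next
    assume "\<bar>Im z\<bar> < - Re z \<and> (1 + Re z) / 2 < Im z"
    then show ?thesis
      by (intro exI[of _ "[(1, 1, 0), (1, -1, 0), (1, -2, -1)]"]) (auto simp: halfplanes_def triangle_pattern_def)
  next
    assume "\<bar>Im z\<bar> < - Re z \<and> Im z < (1 + Re z) / 2"
    then show ?thesis
      by (intro exI[of _ "[(1, 1, 0), (1, -1, 0), (-1, 2, 1)]"]) (auto simp: halfplanes_def triangle_pattern_def)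
  next
    assume "\<bar>Im z\<bar> < Re z \<and> (1 - Re z) / 2 < Im z"
    then show ?thesis
      by (intro exI[of _ "[(-1, 1, 0), (-1, -1, 0), (-1, -2, -1)]"]) (auto simp: halfplanes_def triangle_pattern_def)
  next
    assume "\<bar>Im z\<bar> < Re z \<and> Im z < (1 - Re z) / 2"
    then show ?thesis
      by (intro exI[of _ "[(-1, 1, 0), (-1, -1, 0), (1, 2, 1)]"]) (auto simp: halfplanes_def triangle_pattern_def)
  qed
qed

section \<open>Affine charts at the crossings of the pictures\<close>

lemma affine_crossingI:
  assumes "Re u * Im w \<noteq> Im u * Re w"
    and "\<And>a b. \<bar>a\<bar> < 1 \<Longrightarrow> \<bar>b\<bar> < 1 \<Longrightarrow> affine_chart p u w (Complex a b) \<in> square_interior"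
    and "\<And>a b. \<bar>a\<bar> < 1 \<Longrightarrow> \<bar>b\<bar> < 1 \<Longrightarrow> affine_chart p u w (Complex a b) \<in> T \<longleftrightarrow> a = 0 \<or> b = 0"
  shows "affine_crossing T p u w"
  using assms by (simp add: affine_crossing_def)

text \<open>The vectors follow the diagonals. With entries of size \<open>1/4\<close> the imaginary
  part stays below \<open>1/2\<close>, short of the top of the loop.\<close>

lemma kink_crossing: "affine_crossing kink 0 (Complex (1/4) (1/4)) (Complex (-1/4) (1/4))"
proof (rule affine_crossingI)
  fix a b :: real assume ab: "\<bar>a\<bar> < 1" "\<bar>b\<bar> < 1"
  show "affine_chart 0 (Complex (1/4) (1/4)) (Complex (-1/4) (1/4)) (Complex a b) \<in> square_interior"
    using ab by (simp add: affine_chart_def) linarith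
  show "affine_chart 0 (Complex (1/4) (1/4)) (Complex (-1/4) (1/4)) (Complex a b) \<in> kink \<longleftrightarrow> a = 0 \<or> b = 0"
    using ab by (simp add: affine_chart_def tangle_simps) argo
qed simp

text \<open>Here real parts stay strictly between 0 and 1, away from the other crossing and from the
  sides of the square.\<close>

lemma bigon_crossing_east: "affine_crossing bigon (Complex (1/2) 0) (Complex (1/4) (1/4)) (Complex (-1/4) (1/4))"
proof (rule affine_crossingI)
  fix a b :: real assume ab: "\<bar>a\<bar> < 1" "\<bar>b\<bar> < 1"
  show "affine_chart (Complex (1/2) 0) (Complex (1/4) (1/4)) (Complex (-1/4) (1/4)) (Complex a b) \<in> square_interior"
    using ab by (simp add: affine_chart_def) linarith
  show "affine_chart (Complex (1/2) 0) (Complex (1/4) (1/4)) (Complex (-1/4) (1/4)) (Complex a b) \<in> bigon \<longleftrightarrow> a = 0 \<or> b = 0"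
    using ab by (simp add: affine_chart_def tangle_simps) argo
qed simp

lemma bigon_crossing_west: "affine_crossing bigon (Complex (-1/2) 0) (Complex (1/4) (1/4)) (Complex (-1/4) (1/4))"
proof (rule affine_crossingI)
  fix a b :: real assume ab: "\<bar>a\<bar> < 1" "\<bar>b\<bar> < 1"
  show "affine_chart (Complex (-1/2) 0) (Complex (1/4) (1/4)) (Complex (-1/4) (1/4)) (Complex a b) \<in> square_interior"
    using ab by (simp add: affine_chart_def) linarith
  show "affine_chart (Complex (-1/2) 0) (Complex (1/4) (1/4)) (Complex (-1/4) (1/4)) (Complex a b) \<in> bigon \<longleftrightarrow> a = 0 \<or> b = 0"
    using ab by (simp add: affine_chart_def tangle_simps) argo
qed simp

text \<open>With entries \<open>1/10\<close> both coordinates stay below \<open>1/5\<close> in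
  absolute value, while the third strand runs above height \<open>2/5\<close> there.\<close>

lemma triangle_crossing_origin: "affine_crossing (triangle 1) 0 (Complex (1/10) (1/10)) (Complex (-1/10) (1/10))"
proof (rule affine_crossingI)
  fix a b :: real assume ab: "\<bar>a\<bar> < 1" "\<bar>b\<bar> < 1"
  show "affine_chart 0 (Complex (1/10) (1/10)) (Complex (-1/10) (1/10)) (Complex a b) \<in> square_interior"
    using ab by (simp add: affine_chart_def) linarith
  show "affine_chart 0 (Complex (1/10) (1/10)) (Complex (-1/10) (1/10)) (Complex a b) \<in> (triangle 1) \<longleftrightarrow> a = 0 \<or> b = 0"
    using ab by (simp add: affine_chart_def tangle_simps) argo
qed simp

text \<open>The first vector follows the diagonal, the second the third strand, whose slope is
  \<open>-1/2\<close> here. They are short enough to keep the chart in the open first quadrant,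
  where only these two strands run.\<close>

lemma triangle_crossing_east: "affine_crossing (triangle 1) (Complex (1/3) (1/3)) (Complex (1/20) (1/20)) (Complex (-1/10) (1/20))"
proof (rule affine_crossingI)
  fix a b :: real assume ab: "\<bar>a\<bar> < 1" "\<bar>b\<bar> < 1"
  show "affine_chart (Complex (1/3) (1/3)) (Complex (1/20) (1/20)) (Complex (-1/10) (1/20)) (Complex a b) \<in> square_interior"
    using ab by (simp add: affine_chart_def) linarith
  show "affine_chart (Complex (1/3) (1/3)) (Complex (1/20) (1/20)) (Complex (-1/10) (1/20)) (Complex a b) \<in> (triangle 1) \<longleftrightarrow> a = 0 \<or> b = 0"
    using ab by (simp add: affine_chart_def tangle_simps) argo
qed simp

text \<open>The mirror image of the eastern crossing in the imaginary axis.\<close>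

lemma triangle_crossing_west: "affine_crossing (triangle 1) (Complex (-1/3) (1/3)) (Complex (-1/20) (1/20)) (Complex (1/10) (1/20))"
proof (rule affine_crossingI)
  fix a b :: real assume ab: "\<bar>a\<bar> < 1" "\<bar>b\<bar> < 1"
  show "affine_chart (Complex (-1/3) (1/3)) (Complex (-1/20) (1/20)) (Complex (1/10) (1/20)) (Complex a b) \<in> square_interior"
    using ab by (simp add: affine_chart_def) linarith
  show "affine_chart (Complex (-1/3) (1/3)) (Complex (-1/20) (1/20)) (Complex (1/10) (1/20)) (Complex a b) \<in> (triangle 1) \<longleftrightarrow> a = 0 \<or> b = 0"
    using ab by (simp add: affine_chart_def tangle_simps) argo
qed simp

lemma affine_equation_kink_pattern:
  "affine_equation f (kink_pattern n l s) 0 (Complex (1/4) (1/4)) (Complex (-1/4) (1/4)) \<longleftrightarrow> l = f n s n"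
  by (simp add: affine_equation_def kink_pattern_def)

lemma affine_equation_bigon_pattern:
  "affine_equation f (bigon_pattern n m s w e) (Complex (1/2) 0) (Complex (1/4) (1/4)) (Complex (-1/4) (1/4))
    \<longleftrightarrow> n = f m s e"
  "affine_equation f (bigon_pattern n m s w e) (Complex (-1/2) 0) (Complex (1/4) (1/4)) (Complex (-1/4) (1/4))
    \<longleftrightarrow> n = f w s m"
  by (simp_all add: affine_equation_def bigon_pattern_def)

lemma affine_equation_triangle_pattern:
  "affine_equation f (triangle_pattern t n wu wd s ed eu) 0 (Complex (1/10) (1/10)) (Complex (-1/10) (1/10))
    \<longleftrightarrow> t = f wd s ed"
  "affine_equation f (triangle_pattern t n wu wd s ed eu) (Complex (1/3) (1/3)) (Complex (1/20) (1/20)) (Complex (-1/10) (1/20))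
    \<longleftrightarrow> n = f t ed eu"
  "affine_equation f (triangle_pattern t n wu wd s ed eu) (Complex (-1/3) (1/3)) (Complex (-1/20) (1/20)) (Complex (1/10) (1/20))
    \<longleftrightarrow> n = f t wd wu"
  by (simp_all add: affine_equation_def triangle_pattern_def)

section \<open>The Reidemeister moves\<close>

lemma point_coloring_in_square:
  assumes "tangle_replacement (tangle X F V) T' D D'" "point_coloring A f v D c"
  shows "constant_off (curve D) c" "curve D \<inter> square = X"
    and "\<And>z. z \<in> square - X \<Longrightarrow> c z \<in> A"
    and "(\<forall>p\<in>F. crossing_rule f (curve D) c p) \<and> (\<forall>p\<in>V. crossing_rule v (curve D) c p)"
proof -
  have eq: "curve D \<inter> square = X" "flat_crossings D \<inter> square = F" "virtual_crossings D \<inter> square = V"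
    using assms(1) by (simp_all add: tangle_replacement_def contains_tangle_def)
  show "curve D \<inter> square = X" by (rule eq)
  show "constant_off (curve D) c" using assms(2) by (simp add: point_coloring_def)
  show "c z \<in> A" if "z \<in> square - X" for z
    using assms(2) that eq(1) by (auto simp: point_coloring_def)
  show "(\<forall>p\<in>F. crossing_rule f (curve D) c p) \<and> (\<forall>p\<in>V. crossing_rule v (curve D) c p)"
    using assms(2) eq(2,3) by (auto simp: point_coloring_def)
qed

lemma affine_equation_cong:
  assumes "affine_crossing T p u w" and eq: "\<And>z. z \<in> square - T \<Longrightarrow> c z = e z"
  shows "affine_equation f c p u w \<longleftrightarrow> affine_equation f e p u w"
proof -
  have "affine_chart p u w (Complex a b) \<in> square - T" if "\<bar>a\<bar> = 1/2" "\<bar>b\<bar> = 1/2" for a b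
  proof -
    have "\<bar>a\<bar> < 1" "\<bar>b\<bar> < 1" "a \<noteq> 0" "b \<noteq> 0" using that by auto
    then show ?thesis
      using assms(1) by (auto simp: affine_crossing_def square_def less_imp_le)
  qed
  then have *: "c (affine_chart p u w (Complex a b)) = e (affine_chart p u w (Complex a b))"
    if "\<bar>a\<bar> = 1/2" "\<bar>b\<bar> = 1/2" for a b
    using eq that by blast
  show ?thesis
    unfolding affine_equation_iff[symmetric] crossing_equation_def by (simp add: *)
qed

lemma crossing_rule_pattern:
  assumes "crossing_rule f X c p" "X \<inter> square = T" "affine_crossing T p u w"
    and "\<And>z. z \<in> square - T \<Longrightarrow> c z = e z"
  shows "affine_equation f e p u w"
  using affine_equation_cong[of T p u w c e f, OF assms(3,4)] crossing_rule_affine[OF assms(1-3)] by blast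

text \<open>In the following lemmas the premise \<open>FV\<close> says that \<open>F\<close> and \<open>V\<close> distribute the crossings of the
  tangle over the two crossing types in such a way that \<open>w\<close> is the operation used there; this
  treats flat and virtual moves uniformly.\<close>

lemma strand_kink_lepoll:
  assumes K: "knot_theoretic_ternary_group A f" and L: "knot_theoretic_ternary_group A v"
    and M: "knot_theoretic_ternary_group A w"
    and FV: "\<And>P. (\<forall>p\<in>F. P f p) \<and> (\<forall>p\<in>V. P v p) \<longleftrightarrow> P w (0::complex)"
    and rep: "tangle_replacement (tangle strand {} {}) (tangle kink F V) D D'"
  shows "colorings A f v D \<lesssim> colorings A f v D'"
proof (rule colorings_replacement_lepoll[OF K L rep])
  show "z \<in> curve (tangle strand {} {}) \<longleftrightarrow> z \<in> curve (tangle kink F V)" if "z \<in> square_boundary" for z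
    using that by (simp add: tangle_simps) argo
next
  fix c assume "point_coloring A f v D c"
  note c = point_coloring_in_square[OF rep this]
  let ?n = "c north" and ?s = "c south"
  \<comment> \<open>Around the crossing lie the loop, west, south and east, and both west and east
    belong to the northern face; this forces the color of the loop.\<close>
  let ?e = "kink_pattern ?n (w ?n ?s ?n) ?s"
  have ns: "?n \<in> A" "?s \<in> A" by (auto intro!: c(3) simp: tangle_simps)
  have "?e z \<in> A" for z
    using ns ktg_closed[OF M] by (simp add: kink_pattern_def)
  moreover have "?e z = c z" if z: "z \<in> square_boundary - kink" for z
  proof -
    have "z \<in> square - strand" "\<not> (\<bar>Re z\<bar> < Im z \<and> Im z < 1/2)"
      using z by (simp_all add: tangle_simps) argo+
    then show ?thesis
      using strand_color[OF c(1,2), of z] by (auto simp: kink_pattern_def strand_pattern_def)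
  qed
  moreover have "tangle_crossing w kink ?e 0"
    by (rule tangle_crossing_affine[OF kink_crossing]) (simp only: affine_equation_kink_pattern)
  then have "(\<forall>p\<in>F. tangle_crossing f kink ?e p) \<and> (\<forall>p\<in>V. tangle_crossing v kink ?e p)"
    using FV[of "\<lambda>w p. tangle_crossing w kink ?e p"] by simp
  ultimately show "\<exists>e. locally_constant_on_square (curve (tangle kink F V)) e \<and> (\<forall>z\<in>square. e z \<in> A) \<and>
      (\<forall>z\<in>square_boundary - curve (tangle kink F V). e z = c z) \<and>
      (\<forall>p\<in>flat_crossings (tangle kink F V). tangle_crossing f (curve (tangle kink F V)) e p) \<and>
      (\<forall>p\<in>virtual_crossings (tangle kink F V). tangle_crossing v (curve (tangle kink F V)) e p)"
    by (intro exI[of _ ?e]) (simp add: kink_pattern_locally_constant)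
next
  fix c d z
  assume "point_coloring A f v D c" and "point_coloring A f v D d"
    and eq: "\<And>w. w \<in> square_boundary - curve (tangle strand {} {}) \<Longrightarrow> c w = d w"
    and z: "z \<in> square - curve (tangle strand {} {})"
  note c = point_coloring_in_square[OF rep this(1)] and d = point_coloring_in_square[OF rep this(2)]
  have "c north = d north" "c south = d south"
    by (auto intro!: eq simp: tangle_simps)
  then show "c z = d z"
    using strand_color[OF c(1,2)] strand_color[OF d(1,2)] z by simp
qed

text \<open>The loop is the only face that does not reach the sides of the square, and the crossing
  expresses its color through the other two, so removing it loses no information.\<close>

lemma kink_strand_lepoll:
  assumes K: "knot_theoretic_ternary_group A f" and L: "knot_theoretic_ternary_group A v"
    and FV: "\<And>P. (\<forall>p\<in>F. P f p) \<and> (\<forall>p\<in>V. P v p) \<longleftrightarrow> P w (0::complex)"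
    and rep: "tangle_replacement (tangle kink F V) (tangle strand {} {}) D D'"
  shows "colorings A f v D \<lesssim> colorings A f v D'"
proof (rule colorings_replacement_lepoll[OF K L rep])
  show "z \<in> curve (tangle kink F V) \<longleftrightarrow> z \<in> curve (tangle strand {} {})" if "z \<in> square_boundary" for z
    using that by (simp add: tangle_simps) argo
next
  fix c assume "point_coloring A f v D c"
  note c = point_coloring_in_square[OF rep this]
  let ?e = "strand_pattern (c north) (c south)"
  have "c north \<in> A" "c south \<in> A" by (auto intro!: c(3) simp: tangle_simps)
  then have "?e z \<in> A" for z by (simp add: strand_pattern_def)
  moreover have "?e z = c z" if z: "z \<in> square_boundary - strand" for z
  proof -
    have "z \<in> square - kink" "\<not> (\<bar>Re z\<bar> < Im z \<and> Im z < 1/2)"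
      using z by (simp_all add: tangle_simps) argo+
    then show ?thesis
      using kink_color[OF c(1,2), of z] by (auto simp: kink_pattern_def strand_pattern_def)
  qed
  ultimately show "\<exists>e. locally_constant_on_square (curve (tangle strand {} {})) e \<and> (\<forall>z\<in>square. e z \<in> A) \<and>
      (\<forall>z\<in>square_boundary - curve (tangle strand {} {}). e z = c z) \<and>
      (\<forall>p\<in>flat_crossings (tangle strand {} {}). tangle_crossing f (curve (tangle strand {} {})) e p) \<and>
      (\<forall>p\<in>virtual_crossings (tangle strand {} {}). tangle_crossing v (curve (tangle strand {} {})) e p)"
    by (intro exI[of _ ?e]) (simp add: strand_pattern_locally_constant)
next
  have loop: "c z = kink_pattern (c north) (w (c north) (c south) (c north)) (c south) z"
    if c0: "point_coloring A f v D c" and "z \<in> square - kink" for c z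
  proof -
    note c = point_coloring_in_square[OF rep c0]
    have "crossing_rule w (curve D) c 0"
      using c(4) FV[of "\<lambda>w p. crossing_rule w (curve D) c p"] by simp
    then have "affine_equation w (kink_pattern (c north) (c (Complex 0 (1/4))) (c south)) 0
        (Complex (1/4) (1/4)) (Complex (-1/4) (1/4))"
      by (rule crossing_rule_pattern[OF _ c(2) kink_crossing]) (rule kink_color[OF c(1,2)])
    then have "c (Complex 0 (1/4)) = w (c north) (c south) (c north)"
      by (simp only: affine_equation_kink_pattern)
    then show ?thesis using kink_color[OF c(1,2) that(2)] by simp
  qed
  fix c d z
  assume c: "point_coloring A f v D c" and d: "point_coloring A f v D d"
    and eq: "\<And>w. w \<in> square_boundary - curve (tangle kink F V) \<Longrightarrow> c w = d w"
    and z: "z \<in> square - curve (tangle kink F V)"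
  have "c north = d north" "c south = d south"
    by (auto intro!: eq simp: tangle_simps)
  then show "c z = d z"
    using loop[OF c] loop[OF d] z by simp
qed

text \<open>East and west carry the same color, that of the middle strip, so the equations at the
  two crossings are equivalent by dihedral symmetry and one color of the bigon solves both.\<close>

lemma parallel_bigon_lepoll:
  assumes K: "knot_theoretic_ternary_group A f" and L: "knot_theoretic_ternary_group A v"
    and M: "knot_theoretic_ternary_group A w"
    and FV: "\<And>P. (\<forall>p\<in>F. P f p) \<and> (\<forall>p\<in>V. P v p) \<longleftrightarrow> (\<forall>p\<in>bigon_crossings. P w p)"
    and rep: "tangle_replacement (tangle parallel_strands {} {}) (tangle bigon F V) D D'"
  shows "colorings A f v D \<lesssim> colorings A f v D'"
proof (rule colorings_replacement_lepoll[OF K L rep])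
  show "z \<in> curve (tangle parallel_strands {} {}) \<longleftrightarrow> z \<in> curve (tangle bigon F V)" if "z \<in> square_boundary" for z
    using that by (simp add: tangle_simps) argo
next
  fix c assume "point_coloring A f v D c"
  note c = point_coloring_in_square[OF rep this]
  let ?n = "c north" and ?s = "c south" and ?e = "c east" and ?m = "w (c north) (c east) (c south)"
  let ?b = "bigon_pattern ?n ?m ?s ?e ?e"
  have A: "?n \<in> A" "?e \<in> A" "?s \<in> A" by (auto intro!: c(3) simp: tangle_simps)
  note m = ktg_closed[OF M A]
  have "?b z \<in> A" for z
    using A m by (simp add: bigon_pattern_def)
  moreover have "?b z = c z" if z: "z \<in> square_boundary - parallel_strands" for z
  proof -
    have z': "z \<in> square - parallel_strands" "\<not> (\<bar>Re z\<bar> < 1/2 \<and> \<bar>Im z\<bar> < 1/2)"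
      "1/2 < Im z \<longleftrightarrow> \<bar>\<bar>Re z\<bar> - 1/2\<bar> < Im z" "Im z < -1/2 \<longleftrightarrow> Im z < - \<bar>\<bar>Re z\<bar> - 1/2\<bar>"
      "\<bar>\<bar>Re z\<bar> - 1/2\<bar> < Im z \<or> Im z < - \<bar>\<bar>Re z\<bar> - 1/2\<bar> \<or> \<not> \<bar>Re z\<bar> < 1/2"
      using z by (simp_all add: tangle_simps) argo+
    show ?thesis
      using z'(5) unfolding parallel_color(1)[OF c(1,2) z'(1)] parallel_pattern_def bigon_pattern_def z'(3,4)
      by auto
  qed
  moreover have "square_boundary - parallel_strands = square_boundary - bigon"
    by (auto simp: tangle_simps)
  moreover have "?n = w ?m ?s ?e" "?n = w ?e ?s ?m"
    using ktg_dihedral[OF M m A refl] by auto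
  then have "tangle_crossing w bigon ?b (Complex (1/2) 0)" "tangle_crossing w bigon ?b (Complex (-1/2) 0)"
    by (auto intro!: tangle_crossing_affine[OF bigon_crossing_east] tangle_crossing_affine[OF bigon_crossing_west]
        simp only: affine_equation_bigon_pattern)
  then have "(\<forall>p\<in>F. tangle_crossing f bigon ?b p) \<and> (\<forall>p\<in>V. tangle_crossing v bigon ?b p)"
    unfolding FV[of "\<lambda>w p. tangle_crossing w bigon ?b p"] bigon_crossings_def by simp
  ultimately show "\<exists>e. locally_constant_on_square (curve (tangle bigon F V)) e \<and> (\<forall>z\<in>square. e z \<in> A) \<and>
      (\<forall>z\<in>square_boundary - curve (tangle bigon F V). e z = c z) \<and>
      (\<forall>p\<in>flat_crossings (tangle bigon F V). tangle_crossing f (curve (tangle bigon F V)) e p) \<and>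
      (\<forall>p\<in>virtual_crossings (tangle bigon F V). tangle_crossing v (curve (tangle bigon F V)) e p)"
    by (intro exI[of _ ?b]) (simp add: bigon_pattern_locally_constant)
next
  fix c d z
  assume "point_coloring A f v D c" and "point_coloring A f v D d"
    and eq: "\<And>w. w \<in> square_boundary - curve (tangle parallel_strands {} {}) \<Longrightarrow> c w = d w"
    and z: "z \<in> square - curve (tangle parallel_strands {} {})"
  note c = point_coloring_in_square[OF rep this(1)] and d = point_coloring_in_square[OF rep this(2)]
  have "c north = d north" "c south = d south" "c east = d east"
    by (auto intro!: eq simp: tangle_simps)
  then show "c z = d z"
    using parallel_color(1)[OF c(1,2)] parallel_color(1)[OF d(1,2)] z by simp
qed

text \<open>Both crossings border north, south and the bigon. Solving for the fourth face gives the
  same expression for east and west, so the middle strip of the new picture can receive one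
  color.\<close>

lemma bigon_parallel_lepoll:
  assumes K: "knot_theoretic_ternary_group A f" and L: "knot_theoretic_ternary_group A v"
    and M: "knot_theoretic_ternary_group A w"
    and FV: "\<And>P. (\<forall>p\<in>F. P f p) \<and> (\<forall>p\<in>V. P v p) \<longleftrightarrow> (\<forall>p\<in>bigon_crossings. P w p)"
    and rep: "tangle_replacement (tangle bigon F V) (tangle parallel_strands {} {}) D D'"
  shows "colorings A f v D \<lesssim> colorings A f v D'"
proof (rule colorings_replacement_lepoll[OF K L rep])
  have color: "c west = c east"
    "\<And>z. z \<in> square - bigon \<Longrightarrow>
      c z = bigon_pattern (c north) (w (c north) (c east) (c south)) (c south) (c west) (c east) z"
    if c0: "point_coloring A f v D c" for c
  proof -
    note c = point_coloring_in_square[OF rep c0]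
    let ?b = "bigon_pattern (c north) (c 0) (c south) (c west) (c east)"
    have A: "c north \<in> A" "c 0 \<in> A" "c south \<in> A" "c west \<in> A" "c east \<in> A"
      by (auto intro!: c(3) simp: tangle_simps)
    have rule: "crossing_rule w (curve D) c (Complex (1/2) 0)" "crossing_rule w (curve D) c (Complex (-1/2) 0)"
      using c(4) unfolding FV[of "\<lambda>w p. crossing_rule w (curve D) c p"] bigon_crossings_def by simp_all
    have "affine_equation w ?b (Complex (1/2) 0) (Complex (1/4) (1/4)) (Complex (-1/4) (1/4))"
      by (rule crossing_rule_pattern[OF rule(1) c(2) bigon_crossing_east]) (rule bigon_color[OF c(1,2)])
    moreover have "affine_equation w ?b (Complex (-1/2) 0) (Complex (1/4) (1/4)) (Complex (-1/4) (1/4))"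
      by (rule crossing_rule_pattern[OF rule(2) c(2) bigon_crossing_west]) (rule bigon_color[OF c(1,2)])
    ultimately have n: "c north = w (c 0) (c south) (c east)" "c north = w (c west) (c south) (c 0)"
      unfolding affine_equation_bigon_pattern .
    have m: "c 0 = w (c north) (c east) (c south)"
      by (rule ktg_dihedral(3)[OF M A(1,2,3,5) n(1)])
    have "c east = w (c north) (c 0) (c south)" "c west = w (c north) (c 0) (c south)"
      by (rule ktg_dihedral(6)[OF M A(1,2,3,5) n(1)], rule ktg_dihedral(3)[OF M A(1,4,3,2) n(2)])
    then show "c west = c east" by simp
    show "c z = bigon_pattern (c north) (w (c north) (c east) (c south)) (c south) (c west) (c east) z"
      if "z \<in> square - bigon" for z
      using bigon_color[OF c(1,2) that] unfolding m .
  qed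
  show "z \<in> curve (tangle bigon F V) \<longleftrightarrow> z \<in> curve (tangle parallel_strands {} {})" if "z \<in> square_boundary" for z
    using that by (simp add: tangle_simps) argo
  {
    fix c assume c0: "point_coloring A f v D c"
    note c = point_coloring_in_square[OF rep c0]
    let ?e = "parallel_pattern (c north) (c east) (c south)"
    have "c north \<in> A" "c south \<in> A" "c east \<in> A" by (auto intro!: c(3) simp: tangle_simps)
    then have "?e z \<in> A" for z by (simp add: parallel_pattern_def)
    moreover have "?e z = c z" if z: "z \<in> square_boundary - bigon" for z
    proof -
      have z': "z \<in> square - bigon"
        "\<bar>\<bar>Re z\<bar> - 1/2\<bar> < Im z \<longleftrightarrow> 1/2 < Im z" "Im z < - \<bar>\<bar>Re z\<bar> - 1/2\<bar> \<longleftrightarrow> Im z < -1/2"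
        "1/2 < Im z \<or> Im z < -1/2 \<or> \<not> \<bar>Re z\<bar> < 1/2"
        using z by (simp_all add: tangle_simps) argo+
      show ?thesis
        using z'(4) color(1)[OF c0]
        unfolding color(2)[OF c0 z'(1)] parallel_pattern_def bigon_pattern_def z'(2,3) by auto
    qed
    moreover have "square_boundary - parallel_strands = square_boundary - bigon"
      by (auto simp: tangle_simps)
    ultimately show "\<exists>e. locally_constant_on_square (curve (tangle parallel_strands {} {})) e \<and> (\<forall>z\<in>square. e z \<in> A) \<and>
        (\<forall>z\<in>square_boundary - curve (tangle parallel_strands {} {}). e z = c z) \<and>
        (\<forall>p\<in>flat_crossings (tangle parallel_strands {} {}). tangle_crossing f (curve (tangle parallel_strands {} {})) e p) \<and>
        (\<forall>p\<in>virtual_crossings (tangle parallel_strands {} {}). tangle_crossing v (curve (tangle parallel_strands {} {})) e p)"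
      by (intro exI[of _ ?e]) (simp add: parallel_pattern_locally_constant)
  }
  fix c d z
  assume c: "point_coloring A f v D c" and d: "point_coloring A f v D d"
    and eq: "\<And>w. w \<in> square_boundary - curve (tangle bigon F V) \<Longrightarrow> c w = d w"
    and z: "z \<in> square - curve (tangle bigon F V)"
  have "c north = d north" "c south = d south" "c east = d east" "c west = d west"
    by (auto intro!: eq simp: tangle_simps)
  moreover have "z \<in> square - bigon" using z by simp
  ultimately show "c z = d z"
    using color(2)[OF c] color(2)[OF d] by metis
qed

section \<open>Reflection in the real axis and moves of type III\<close>

lemma homeomorphism_cnj: "homeomorphism UNIV UNIV cnj cnj"
  by (intro homeomorphismI) (auto intro!: continuous_intros)

lemma image_cnj_iff: "z \<in> cnj ` S \<longleftrightarrow> cnj z \<in> S"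
  by (metis complex_cnj_cnj image_iff)

lemma cnj_image_triangle: "cnj ` triangle s = triangle (- s)"
  by (rule set_eqI) (auto simp: image_cnj_iff triangle_def square_def)

lemma cnj_image_third_strand_crossings: "cnj ` third_strand_crossings s = third_strand_crossings (- s)"
  by (simp add: third_strand_crossings_def complex_cnj)

lemma locally_constant_on_square_cnj:
  assumes "locally_constant_on_square T e"
  shows "locally_constant_on_square (cnj ` T) (\<lambda>z. e (cnj z))"
  unfolding locally_constant_on_square_def
proof
  fix z assume "z \<in> square - cnj ` T"
  then have "cnj z \<in> square - T" by (simp add: image_cnj_iff square_def)
  then obtain U where U: "open U" "cnj z \<in> U" "\<And>w. w \<in> U \<inter> square \<Longrightarrow> e w = e (cnj z)"
    using assms unfolding locally_constant_on_square_def by meson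
  have "open (cnj ` U)"
    using homeomorphism_open_image[OF homeomorphism_cnj] U(1) by simp
  moreover have "e (cnj w) = e (cnj z)" if "w \<in> cnj ` U \<inter> square" for w
    using that by (intro U(3)) (simp add: image_cnj_iff square_def)
  ultimately show "\<exists>U. open U \<and> z \<in> U \<and> (\<forall>w\<in>U \<inter> square. e (cnj w) = e (cnj z))"
    using U(2) by (intro exI[of _ "cnj ` U"]) (simp add: image_cnj_iff)
qed

text \<open>Charts carry no orientation, so composing one with \<open>cnj\<close> gives a chart of
  the reflected tangle with the same sampled colors in the same order.\<close>

lemma tangle_crossing_cnj:
  assumes "tangle_crossing f T e p"
  shows "tangle_crossing f (cnj ` T) (\<lambda>z. e (cnj z)) (cnj p)"
proof -
  obtain \<phi> where \<phi>: "local_chart cross_model T p \<phi>" "\<phi> ` ball 0 1 \<subseteq> square_interior" "crossing_equation f e \<phi>"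
    using assms by (auto simp: tangle_crossing_def)
  have "local_chart cross_model (cnj ` T) (cnj p) (cnj \<circ> \<phi>)"
    by (rule local_chart_homeomorphism[OF \<phi>(1) homeomorphism_cnj])
  moreover have "(cnj \<circ> \<phi>) ` ball 0 1 \<subseteq> square_interior"
    using \<phi>(2) by auto
  moreover have "crossing_equation f (\<lambda>z. e (cnj z)) (cnj \<circ> \<phi>)"
    using \<phi>(3) by (simp add: crossing_equation_def)
  ultimately show ?thesis unfolding tangle_crossing_def by blast
qed

text \<open>The three equations solved for the central color: the form expected by
  \<open>compatible_triangle\<close>. The first also shows that the sides of the square determine
  the central color.\<close>

lemma triangle_color_crossings:
  assumes M: "knot_theoretic_ternary_group A g" and D: "curve D \<inter> square = triangle 1"
    and const: "constant_off (curve D) c" and cA: "\<And>z. z \<in> square - triangle 1 \<Longrightarrow> c z \<in> A"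
    and rule: "crossing_rule f (curve D) c 0" "\<forall>p\<in>third_strand_crossings 1. crossing_rule g (curve D) c p"
  shows "c (Complex 0 (1/4)) = f (c (Complex (-1) (-1/2))) (c south) (c (Complex 1 (-1/2)))"
    and "c (Complex 0 (1/4)) = g (c north) (c (Complex 1 (1/2))) (c (Complex 1 (-1/2)))"
    and "c (Complex 0 (1/4)) = g (c north) (c (Complex (-1) (1/2))) (c (Complex (-1) (-1/2)))"
proof -
  let ?e = "triangle_pattern (c (Complex 0 (1/4))) (c north) (c (Complex (-1) (1/2)))
    (c (Complex (-1) (-1/2))) (c south) (c (Complex 1 (-1/2))) (c (Complex 1 (1/2)))"
  have A: "c (Complex 0 (1/4)) \<in> A" "c north \<in> A" "c (Complex (-1) (1/2)) \<in> A"
    "c (Complex (-1) (-1/2)) \<in> A" "c (Complex 1 (-1/2)) \<in> A" "c (Complex 1 (1/2)) \<in> A"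
    by (auto intro!: cA simp: tangle_simps)
  have rule': "crossing_rule g (curve D) c (Complex (1/3) (1/3))" "crossing_rule g (curve D) c (Complex (-1/3) (1/3))"
    using rule(2) by (simp_all add: third_strand_crossings_def)
  have "affine_equation f ?e 0 (Complex (1/10) (1/10)) (Complex (-1/10) (1/10))"
    by (rule crossing_rule_pattern[OF rule(1) D triangle_crossing_origin]) (rule triangle_color[OF const D])
  then show "c (Complex 0 (1/4)) = f (c (Complex (-1) (-1/2))) (c south) (c (Complex 1 (-1/2)))"
    unfolding affine_equation_triangle_pattern .
  have "affine_equation g ?e (Complex (1/3) (1/3)) (Complex (1/20) (1/20)) (Complex (-1/10) (1/20))"
    by (rule crossing_rule_pattern[OF rule'(1) D triangle_crossing_east]) (rule triangle_color[OF const D])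
  then have "c north = g (c (Complex 0 (1/4))) (c (Complex 1 (-1/2))) (c (Complex 1 (1/2)))"
    unfolding affine_equation_triangle_pattern .
  then show "c (Complex 0 (1/4)) = g (c north) (c (Complex 1 (1/2))) (c (Complex 1 (-1/2)))"
    by (rule ktg_dihedral(3)[OF M A(2,1,5,6)])
  have "affine_equation g ?e (Complex (-1/3) (1/3)) (Complex (-1/20) (1/20)) (Complex (1/10) (1/20))"
    by (rule crossing_rule_pattern[OF rule'(2) D triangle_crossing_west]) (rule triangle_color[OF const D])
  then have "c north = g (c (Complex 0 (1/4))) (c (Complex (-1) (-1/2))) (c (Complex (-1) (1/2)))"
    unfolding affine_equation_triangle_pattern .
  then show "c (Complex 0 (1/4)) = g (c north) (c (Complex (-1) (1/2))) (c (Complex (-1) (-1/2)))"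
    by (rule ktg_dihedral(3)[OF M A(2,1,4,3)])
qed

lemma triangle_pattern_crossings:
  assumes "t = f wd s ed" "n = g t ed eu" "n = g t wd wu"
  shows "tangle_crossing f (triangle 1) (triangle_pattern t n wu wd s ed eu) 0"
    and "tangle_crossing g (triangle 1) (triangle_pattern t n wu wd s ed eu) (Complex (1/3) (1/3))"
    and "tangle_crossing g (triangle 1) (triangle_pattern t n wu wd s ed eu) (Complex (-1/3) (1/3))"
  using assms
  by (auto intro!: tangle_crossing_affine[OF triangle_crossing_origin] tangle_crossing_affine[OF triangle_crossing_east]
      tangle_crossing_affine[OF triangle_crossing_west] simp only: affine_equation_triangle_pattern)

text \<open>The arguments on the left are permuted by the reflection: north with south, upper with
  lower. The central triangle does not reach the sides of the square, so \<open>t'\<close> and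
  \<open>t\<close> may differ.\<close>

lemma triangle_pattern_boundary:
  assumes "z \<in> square_boundary - triangle (- 1)"
  shows "triangle_pattern t' s wd wu n eu ed (cnj z) = triangle_pattern t n wu wd s ed eu z"
proof -
  have z: "\<bar>Im z\<bar> \<noteq> \<bar>Re z\<bar>" "\<bar>Re z\<bar> = 1 \<and> \<bar>Im z\<bar> < 1 \<and> Im z \<noteq> 0 \<or> \<bar>Im z\<bar> = 1 \<and> \<bar>Re z\<bar> < 1"
    using assms by (auto simp: tangle_simps)
  from z(2) show ?thesis
  proof
    assume h: "\<bar>Re z\<bar> = 1 \<and> \<bar>Im z\<bar> < 1 \<and> Im z \<noteq> 0"
    then have "\<not> \<bar>Re z\<bar> < Im z" "\<not> Im z < - \<bar>Re z\<bar>" "\<not> \<bar>Re z\<bar> < - Im z" "\<not> - Im z < - \<bar>Re z\<bar>"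
      by linarith+
    then show ?thesis
      using h by (auto simp: triangle_pattern_def)
  next
    assume h: "\<bar>Im z\<bar> = 1 \<and> \<bar>Re z\<bar> < 1"
    then consider "\<bar>Re z\<bar> < Im z" "(1 - \<bar>Re z\<bar>) / 2 < Im z" "\<not> \<bar>Re z\<bar> < - Im z" "- Im z < - \<bar>Re z\<bar>"
      | "\<bar>Re z\<bar> < - Im z" "(1 - \<bar>Re z\<bar>) / 2 < - Im z" "\<not> \<bar>Re z\<bar> < Im z" "Im z < - \<bar>Re z\<bar>"
      by argo
    then show ?thesis
      by cases (simp_all only: triangle_pattern_def cnj.sel if_True if_False)
  qed
qed

text \<open>\<open>f'\<close> belongs to the crossing of the diagonals and \<open>v'\<close> to the
  two crossings on the third strand. The six outer colors are kept and only the central one is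
  replaced.\<close>

lemma triangle_lepoll:
  fixes F V :: "real \<Rightarrow> complex set"
  assumes K: "knot_theoretic_ternary_group A f" and L: "knot_theoretic_ternary_group A v"
    and K': "knot_theoretic_ternary_group A f'" and L': "knot_theoretic_ternary_group A v'"
    and compat: "compatible A f' v'"
    and FV: "\<And>P s. (\<forall>p\<in>F s. P f p) \<and> (\<forall>p\<in>V s. P v p) \<longleftrightarrow> P f' 0 \<and> (\<forall>p\<in>third_strand_crossings s. P v' p)"
    and rep: "tangle_replacement (tangle (triangle 1) (F 1) (V 1)) (tangle (triangle (-1)) (F (-1)) (V (-1))) D D'"
  shows "colorings A f v D \<lesssim> colorings A f v D'"
proof (rule colorings_replacement_lepoll[OF K L rep])
  let ?T = "tangle (triangle 1) (F 1) (V 1)" and ?T' = "tangle (triangle (-1)) (F (-1)) (V (-1))"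
  have crossings: "c (Complex 0 (1/4)) = f' (c (Complex (-1) (-1/2))) (c south) (c (Complex 1 (-1/2)))"
    "c (Complex 0 (1/4)) = v' (c north) (c (Complex 1 (1/2))) (c (Complex 1 (-1/2)))"
    "c (Complex 0 (1/4)) = v' (c north) (c (Complex (-1) (1/2))) (c (Complex (-1) (-1/2)))"
    if c0: "point_coloring A f v D c" for c
  proof -
    note c = point_coloring_in_square[OF rep c0]
    have r: "crossing_rule f' (curve D) c 0" "\<forall>p\<in>third_strand_crossings 1. crossing_rule v' (curve D) c p"
      using c(4) unfolding FV[of 1 "\<lambda>w p. crossing_rule w (curve D) c p"] by simp_all
    show "c (Complex 0 (1/4)) = f' (c (Complex (-1) (-1/2))) (c south) (c (Complex 1 (-1/2)))"
      by (rule triangle_color_crossings(1)[OF L' c(2,1) _ r]) (rule c(3))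
    show "c (Complex 0 (1/4)) = v' (c north) (c (Complex 1 (1/2))) (c (Complex 1 (-1/2)))"
      by (rule triangle_color_crossings(2)[OF L' c(2,1) _ r]) (rule c(3))
    show "c (Complex 0 (1/4)) = v' (c north) (c (Complex (-1) (1/2))) (c (Complex (-1) (-1/2)))"
      by (rule triangle_color_crossings(3)[OF L' c(2,1) _ r]) (rule c(3))
  qed
  show boundary: "z \<in> curve ?T \<longleftrightarrow> z \<in> curve ?T'" if "z \<in> square_boundary" for z
    using that by (auto simp: tangle_simps)
  {
    fix c assume c0: "point_coloring A f v D c"
    note c = point_coloring_in_square[OF rep c0]
    let ?t = "c (Complex 0 (1/4))" and ?n = "c north" and ?wu = "c (Complex (-1) (1/2))"
      and ?wd = "c (Complex (-1) (-1/2))" and ?s = "c south" and ?ed = "c (Complex 1 (-1/2))"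
      and ?eu = "c (Complex 1 (1/2))"
    \<comment> \<open>The crossing of the diagonals defines the new central color; the equations at
      the other two crossings then have to be proved.\<close>
    let ?t' = "f' ?wu ?n ?eu"
    let ?p = "triangle_pattern ?t' ?s ?wd ?wu ?n ?eu ?ed"
    let ?e = "\<lambda>z. ?p (cnj z)"
    have A: "?t \<in> A" "?n \<in> A" "?wu \<in> A" "?wd \<in> A" "?s \<in> A" "?ed \<in> A" "?eu \<in> A"
      by (auto intro!: c(3) simp: tangle_simps)
    have t': "?t' \<in> A" using A ktg_closed[OF K'] by blast
    have 1: "?t' = v' ?s ?wd ?wu"
      by (rule compatible_triangle[OF K' L' compat A crossings(1,3,2)[OF c0]])
    \<comment> \<open>The last crossing is the mirror image of the previous one:
      \<open>compatible_triangle\<close> is applied with east and west exchanged, and commutativity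
      identifies the two forms of the central color.\<close>
    have "?t = f' ?ed ?s ?wd"
      using crossings(1)[OF c0] ktg_commute[OF K' A(4,5,6)] by metis
    then have "f' ?eu ?n ?wu = v' ?s ?ed ?eu"
      by (rule compatible_triangle[OF K' L' compat A(1,2,7,6,5,4,3) _ crossings(2,3)[OF c0]])
    then have 2: "?t' = v' ?s ?ed ?eu"
      using ktg_commute[OF K' A(3,2,7)] by metis
    note s1 = ktg_dihedral(3)[OF L' t' A(5,4,3) 1] and s2 = ktg_dihedral(3)[OF L' t' A(5,6,7) 2]
    have "tangle_crossing f' (triangle 1) ?p 0" "tangle_crossing v' (triangle 1) ?p (Complex (1/3) (1/3))"
      "tangle_crossing v' (triangle 1) ?p (Complex (-1/3) (1/3))"
      by (rule triangle_pattern_crossings(1)[where g = v'] triangle_pattern_crossings(2,3)[where f = f'],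
          rule refl, rule s2, rule s1)+
    note x = this[THEN tangle_crossing_cnj]
    have "tangle_crossing f' (triangle (-1)) ?e 0 \<and>
        (\<forall>p\<in>third_strand_crossings (-1). tangle_crossing v' (triangle (-1)) ?e p)"
      using x by (simp add: cnj_image_triangle third_strand_crossings_def complex_cnj)
    then have "(\<forall>p\<in>F (-1). tangle_crossing f (triangle (-1)) ?e p) \<and> (\<forall>p\<in>V (-1). tangle_crossing v (triangle (-1)) ?e p)"
      unfolding FV[of "-1" "\<lambda>w p. tangle_crossing w (triangle (-1)) ?e p"] .
    moreover have "locally_constant_on_square (triangle (-1)) ?e"
      using locally_constant_on_square_cnj[OF triangle_pattern_locally_constant]
      by (simp only: cnj_image_triangle)
    moreover have "?e z \<in> A" for z
      using A t' by (simp add: triangle_pattern_def)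
    moreover have "?e z = c z" if z: "z \<in> square_boundary - triangle (-1)" for z
    proof -
      have "z \<in> square - triangle 1"
        using z boundary[of z] by (auto simp: square_boundary_def)
      from triangle_color[OF c(1,2) this] show ?thesis
        by (intro trans[OF triangle_pattern_boundary[OF z]]) (rule sym)
    qed
    ultimately show "\<exists>e. locally_constant_on_square (curve ?T') e \<and> (\<forall>z\<in>square. e z \<in> A) \<and>
      (\<forall>z\<in>square_boundary - curve ?T'. e z = c z) \<and>
      (\<forall>p\<in>flat_crossings ?T'. tangle_crossing f (curve ?T') e p) \<and>
      (\<forall>p\<in>virtual_crossings ?T'. tangle_crossing v (curve ?T') e p)"
      by (intro exI[of _ ?e]) simp
  }
  fix c d z
  assume c0: "point_coloring A f v D c" and d0: "point_coloring A f v D d"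
    and eq: "\<And>w. w \<in> square_boundary - curve ?T \<Longrightarrow> c w = d w"
    and z: "z \<in> square - curve ?T"
  note c = point_coloring_in_square[OF rep c0] and d = point_coloring_in_square[OF rep d0]
  have e: "c north = d north" "c (Complex (-1) (1/2)) = d (Complex (-1) (1/2))"
    "c (Complex (-1) (-1/2)) = d (Complex (-1) (-1/2))" "c south = d south"
    "c (Complex 1 (-1/2)) = d (Complex 1 (-1/2))" "c (Complex 1 (1/2)) = d (Complex 1 (1/2))"
    by (rule eq; simp add: tangle_simps)+
  have z': "z \<in> square - triangle 1" using z by simp
  show "c z = d z"
    unfolding triangle_color[OF c(1,2) z'] triangle_color[OF d(1,2) z']
      crossings(1)[OF c0] crossings(1)[OF d0] e by (rule refl)
qed

lemma tangle_replacement_map: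
  assumes k: "homeomorphism UNIV UNIV k k'" "k ` square = square"
    and rep: "tangle_replacement T T' D D'"
  shows "tangle_replacement (map_diagram k T) (map_diagram k T') (map_diagram k D) (map_diagram k D')"
proof -
  have "inj k" using k(1) by (metis homeomorphism_def inj_on_inverseI UNIV_I)
  then have "k ` X \<inter> square = k ` (X \<inter> square)" "k ` X - square = k ` (X - square)" for X
    using k(2) image_Int[of k X square] image_set_diff[of k X square] by auto
  moreover have "closed (k ` X)" if "closed X" for X
    using homeomorphism_imp_closed_map[OF k(1)] that by auto
  ultimately show ?thesis
    using rep by (simp add: tangle_replacement_def contains_tangle_def agree_outside_def)
qed

text \<open>The reflection \<open>cnj\<close> exchanges the two sides of the move, so an injection in one direction
  yields one in the other.\<close>

lemma triangle_eqpoll: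
  fixes F V :: "real \<Rightarrow> complex set"
  assumes K: "knot_theoretic_ternary_group A f" and L: "knot_theoretic_ternary_group A v"
    and K': "knot_theoretic_ternary_group A f'" and L': "knot_theoretic_ternary_group A v'"
    and compat: "compatible A f' v'"
    and FV: "\<And>P s. (\<forall>p\<in>F s. P f p) \<and> (\<forall>p\<in>V s. P v p) \<longleftrightarrow> P f' 0 \<and> (\<forall>p\<in>third_strand_crossings s. P v' p)"
    and cnj: "\<And>s. cnj ` F s = F (- s)" "\<And>s. cnj ` V s = V (- s)"
    and rep: "tangle_replacement (tangle (triangle 1) (F 1) (V 1)) (tangle (triangle (-1)) (F (-1)) (V (-1))) D D'"
  shows "colorings A f v D \<approx> colorings A f v D'"
proof (rule lepoll_antisym)
  show "colorings A f v D \<lesssim> colorings A f v D'"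
    using K L K' L' compat FV rep by (rule triangle_lepoll)
  have "cnj ` square = square"
    by (rule set_eqI) (simp add: image_cnj_iff square_def)
  from tangle_replacement_map[OF homeomorphism_cnj this tangle_replacement_sym[OF rep]]
  have "tangle_replacement (tangle (triangle 1) (F 1) (V 1)) (tangle (triangle (-1)) (F (-1)) (V (-1)))
      (map_diagram cnj D') (map_diagram cnj D)"
    by (simp add: map_diagram_def cnj cnj_image_triangle)
  with K L K' L' compat FV have "colorings A f v (map_diagram cnj D') \<lesssim> colorings A f v (map_diagram cnj D)"
    by (rule triangle_lepoll)
  then show "colorings A f v D' \<lesssim> colorings A f v D"
    using colorings_map_eqpoll[OF homeomorphism_cnj, of A f v]
    by (meson eqpoll_imp_lepoll eqpoll_sym lepoll_trans)
qed

text \<open>For moves III the pair \<open>(f', v')\<close> is \<open>(f, f)\<close>,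
  \<open>(v, v)\<close> or \<open>(f, v)\<close>. Moves I and II combine two separate injections,
  whereas \<open>triangle_eqpoll\<close> already covers both directions.\<close>

lemma colorings_tangle_replacement:
  assumes K: "knot_theoretic_ternary_group A f" and L: "knot_theoretic_ternary_group A v"
    and compat: "compatible A f v"
    and "reidemeister_tangles T T'" and rep: "tangle_replacement T T' D D'"
  shows "colorings A f v D \<approx> colorings A f v D'"
  using assms(4)
proof cases
  case flat_I
  show ?thesis
    using rep unfolding flat_I
    by (intro lepoll_antisym strand_kink_lepoll[OF K L K, where F = "{0}" and V = "{}"]
        kink_strand_lepoll[OF K L, where F = "{0}" and V = "{}" and w = f]) (auto dest: tangle_replacement_sym)
next
  case virtual_I
  show ?thesis
    using rep unfolding virtual_I
    by (intro lepoll_antisym strand_kink_lepoll[OF K L L, where F = "{}" and V = "{0}"]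
        kink_strand_lepoll[OF K L, where F = "{}" and V = "{0}" and w = v]) (auto dest: tangle_replacement_sym)
next
  case flat_II
  show ?thesis
    using rep unfolding flat_II
    by (intro lepoll_antisym parallel_bigon_lepoll[OF K L K, where F = bigon_crossings and V = "{}"]
        bigon_parallel_lepoll[OF K L K, where F = bigon_crossings and V = "{}"]) (auto dest: tangle_replacement_sym)
next
  case virtual_II
  show ?thesis
    using rep unfolding virtual_II
    by (intro lepoll_antisym parallel_bigon_lepoll[OF K L L, where F = "{}" and V = bigon_crossings]
        bigon_parallel_lepoll[OF K L L, where F = "{}" and V = bigon_crossings]) (auto dest: tangle_replacement_sym)
next
  case flat_III
  show ?thesis
    using rep unfolding flat_III
    by (intro triangle_eqpoll[OF K L K K compatible_self[OF K],
          where F = "\<lambda>s. {0} \<union> third_strand_crossings s" and V = "\<lambda>s. {}"])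
      (simp_all add: cnj_image_third_strand_crossings)
next
  case virtual_III
  show ?thesis
    using rep unfolding virtual_III
    by (intro triangle_eqpoll[OF K L L L compatible_self[OF L],
          where F = "\<lambda>s. {}" and V = "\<lambda>s. {0} \<union> third_strand_crossings s"])
      (simp_all add: cnj_image_third_strand_crossings)
next
  case mixed_III
  show ?thesis
    using rep unfolding mixed_III
    by (intro triangle_eqpoll[OF K L K L compat,
          where F = "\<lambda>s. {0}" and V = "\<lambda>s. third_strand_crossings s"])
      (simp_all add: cnj_image_third_strand_crossings)
qed

text \<open>The inverse \<open>g\<close> of \<open>h\<close> carries the disk of the move to the
  standard square, and transport along \<open>g\<close> preserves the number of colorings of both
  diagrams.\<close>

lemma colorings_reidemeister_move:
  assumes K: "knot_theoretic_ternary_group A f" and L: "knot_theoretic_ternary_group A v"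
    and compat: "compatible A f v"
    and closed: "closed (curve D)" "closed (curve D')" and "reidemeister_move D D'"
  shows "colorings A f v D \<approx> colorings A f v D'"
proof -
  obtain T T' h g where T: "reidemeister_tangles T T' \<or> reidemeister_tangles T' T"
    and h: "homeomorphism UNIV UNIV h g"
    and D: "contains_tangle h T D" "contains_tangle h T' D'" "agree_outside (h ` square) D D'"
    using assms(6) unfolding reidemeister_move_def by blast
  have gh: "g (h z) = z" for z using h by (simp add: homeomorphism_def)
  then have im: "g ` h ` S = S" for S by (simp add: image_comp comp_def)
  have g: "homeomorphism UNIV UNIV g h" using h by (rule homeomorphism_symD)
  have "inj g" using g by (metis homeomorphism_def inj_on_inverseI UNIV_I)
  then have int: "g ` X \<inter> square = g ` (X \<inter> h ` square)" and diff: "g ` X - square = g ` (X - h ` square)" for X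
    using image_Int[of g X "h ` square"] image_set_diff[of g X "h ` square"] by (simp_all add: im)
  have "closed (g ` X)" if "closed X" for X
    using homeomorphism_imp_closed_map[OF g] that by auto
  then have "tangle_replacement T T' (map_diagram g D) (map_diagram g D')"
    using D closed by (simp add: tangle_replacement_def contains_tangle_def agree_outside_def int diff im)
  then have "colorings A f v (map_diagram g D) \<approx> colorings A f v (map_diagram g D')"
    using T colorings_tangle_replacement[OF K L compat] tangle_replacement_sym eqpoll_sym by metis
  then show ?thesis
    using colorings_map_eqpoll[OF g, of A f v] by (meson eqpoll_sym eqpoll_trans)
qed

theorem theorem6p6:
  fixes A :: "'a set"
    and f v :: "'a \<Rightarrow> 'a \<Rightarrow> 'a \<Rightarrow> 'a"
    and D D' :: diagram
  assumes "knot_theoretic_ternary_group A f"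
    and "knot_theoretic_ternary_group A v"
    and "compatible A f v"
    and "flat_virtual_link_diagram D"
    and "flat_virtual_link_diagram D'"
    and "planar_isotopic D D' \<or> reidemeister_move D D'"
  shows "colorings A f v D \<approx> colorings A f v D'"
proof -
  have "closed (curve D)" "closed (curve D')"
    using assms(4,5) by (simp_all add: flat_virtual_link_diagram_def compact_imp_closed)
  then show ?thesis
    using assms(6) colorings_planar_isotopic colorings_reidemeister_move[OF assms(1-3)] by blast
qed

end
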